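(* Fix integers $r,s$ with $0\le s<r$. There is a constant $C=C(r,s)$ such that for all $n$ and all integers $t\ge 2$, $$\operatorname{hom}(C_t,G(n,r,s))=N_1^t\left(1+\delta_0+\sum_{j=1}^{s}\frac{n^j}{j!}\left(\frac{\binom{r-j}{s-j}}{\binom{r}{s}}+\delta_j\right)^t\right)$$ for some real numbers $\delta_0,\dots,\delta_s$ (depending on $n,t$) with $|\delta_j|\le C/n$ for all $j$. Moreover, suppose $s\ge 1$ and fix $\varepsilon>0$. For $j\in\{0,1,\dots,s-1\}$ put $a_j=\ln\binom{r-j}{s-j}-\ln\binom{r-j-1}{s-j-1}=\ln\frac{r-j}{s-j}$ (so $a_0<a_1<\dots<a_{s-1}$, $a_0=\ln(r/s)$, $a_{s-1}=\ln(r-s+1)$). Define the sets of positive integers $$I_0=\{t:\ t>(1+\varepsilon)\ln n/a_0\},\qquad I_s=\{t:\ 2\le t<(1-\varepsilon)\ln n/a_{s-1}\},$$ $$I_j=\{t:\ (1+\varepsilon)\ln n/a_j<t<(1-\varepsilon)\ln n/a_{j-1}\},\quad j\in\{1,\dots,s-1\}.$$ Then for every $j\in\{0,\dots,s\}$ and every sequence $t=t(n)\in I_j$, $$\operatorname{hom}(C_t,G(n,r,s))\sim N_1^t\,\frac{n^j}{j!}\left(\frac{\binom{r-j}{s-j}}{\binom{r}{s}}\right)^t\qquad(n\to\infty).$$ In particular $\operatorname{hom}(C_t)\sim N_1^t$ for $t\in I_0$ and $\operatorname{hom}(C_t)\sim N_1^t\frac{n^s}{s!}\binom{r}{s}^{-t}$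 for $t\in I_s$.
   Context: For integers $0\le s<r<n$, the generalized Johnson graph $G(n,r,s)$ is the simple graph whose vertices are the $r$-element subsets of $\{1,\dots,n\}$, two vertices $x,y$ being adjacent iff $|x\cap y|=s$. Here $r,s$ are constants and $n\to\infty$. Let $N=\binom{n}{r}$ and $N_1=\binom{r}{s}\binom{n-r}{r-s}$ (the vertex degree). $C_t$ denotes the cycle on $t$ vertices, and $\operatorname{hom}(H,G)$ is the number of graph homomorphisms (edge-preserving maps $V(H)\to V(G)$) from $H$ to $G$. *)

theory Defs
  imports "HOL-Analysis.Analysis" "HOL-Library.Landau_Symbols"
begin

definition johnson_vertices :: "nat \<Rightarrow> nat \<Rightarrow> nat set set" where
  "johnson_vertices n r = {x. x \<subseteq> {1..n} \<and> card x = r}"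

definition johnson_adj :: "nat \<Rightarrow> nat set \<Rightarrow> nat set \<Rightarrow> bool" where
  "johnson_adj s x y \<longleftrightarrow> x \<noteq> y \<and> card (x \<inter> y) = s"

text \<open>hom(C_t, G(n,r,s)): maps from the vertex set Z_t of the cycle C_t
  (encoded as lists of length t) into the vertex set such that consecutive
  (cyclically) vertices are adjacent.\<close>
definition hom_cycle_johnson :: "nat \<Rightarrow> nat \<Rightarrow> nat \<Rightarrow> nat \<Rightarrow> nat" where
  "hom_cycle_johnson t n r s =
     card {xs. length xs = t \<and> set xs \<subseteq> johnson_vertices n r \<and>
               (\<forall>i<t. johnson_adj s (xs ! i) (xs ! ((i + 1) mod t)))}"

text \<open>Vertex degree N_1 = binom(r,s) binom(n-r,r-s).\<close>
definition johnson_N1 :: "nat \<Rightarrow> nat \<Rightarrow> nat \<Rightarrow> nat" where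
  "johnson_N1 n r s = (r choose s) * ((n - r) choose (r - s))"

definition johnson_a :: "nat \<Rightarrow> nat \<Rightarrow> nat \<Rightarrow> real" where
  "johnson_a r s j = ln (real (r - j) / real (s - j))"

definition johnson_I :: "nat \<Rightarrow> nat \<Rightarrow> real \<Rightarrow> nat \<Rightarrow> nat \<Rightarrow> nat \<Rightarrow> bool" where
  "johnson_I r s eps j n t \<longleftrightarrow> t \<ge> 1 \<and>
     (if j = 0 then real t > (1 + eps) * ln (real n) / johnson_a r s 0
      else if j = s then 2 \<le> t \<and> real t < (1 - eps) * ln (real n) / johnson_a r s (s - 1)
      else (1 + eps) * ln (real n) / johnson_a r s j < real t \<and>
           real t < (1 - eps) * ln (real n) / johnson_a r s (j - 1))"

end

theory Submission
  imports Defs "HOL-Real_Asymp.Real_Asymp"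
begin

text \<open>The number of homomorphisms from \<open>C\<^sub>t\<close> is the number of closed walks of length \<open>t\<close>, i.e. the trace of
  the \<open>t\<close>-th power of the adjacency matrix. This matrix lies in the algebra spanned by the kernels
  \<open>card (x \<inter> y) choose k\<close>, and each product of \<open>j\<close> differences of coordinate functions is a common
  eigenvector of all these kernels, with eigenvalue \<open>\<mu> k j\<close>, triangular in \<open>k, j\<close>. So \<open>\<mu> \<cdot> j\<close> is a
  character of the algebra, and expanding the trace in these characters, with weights \<open>m j\<close> that solve
  a triangular linear system, gives \<open>\<Sum>j\<le>r. m j * \<lambda> j ^ t\<close>. No diagonalisation and no rank
  computation is needed. Asymptotically \<open>m j\<close> is \<open>n ^ j / j!\<close>, and \<open>\<lambda> j / N\<^sub>1\<close> tends to the stated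
  limit for \<open>j \<le> s\<close>; the relative error of \<open>m j\<close> is absorbed into \<open>\<delta> j\<close> by taking a \<open>t\<close>-th root. For
  \<open>j > s\<close> the eigenvalues are so small that these terms can be absorbed into \<open>\<delta> s\<close>.\<close>

section \<open>The kernels of the Johnson scheme\<close>

text \<open>Once a power of the adjacency matrix is a combination of kernels, its trace and each of
  its eigenvalues are linear in the same coefficients, so weights that reproduce the traces of the
  kernels reproduce the trace of every power. One nonzero eigenvector per index \<open>j\<close> is
  enough for this. The obstacle is uniformity in \<open>t\<close>: a factor 1 + O(1/n) raised to an
  unrestricted power is not under control. Errors of eigenvalues must therefore stay inside the t-th
  power, while the error of a multiplicity, which occurs once, is pushed into it; the root costs
  nothing, because it only moves a nonnegative number closer to 1. Index 0 must be free of the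
  power, which works because its eigenvalue is exactly the degree. The restriction
  \<open>t \<ge> 2\<close> comes from \<open>j > s\<close>: multiplicity n^j and eigenvalue ratio
  n^-(j-s) give, up to constants, n^s at t = 1 but n^s / n^(j-s) at t = 2.\<close>

definition subs :: "nat \<Rightarrow> 'a set \<Rightarrow> 'a set set" where
  "subs k x = {S. S \<subseteq> x \<and> card S = k}"

lemma johnson_vertices_subs: "johnson_vertices n r = subs r {1..n}"
  by (simp add: johnson_vertices_def subs_def)

lemma finite_subs [simp]: "finite x \<Longrightarrow> finite (subs k x)"
  by (simp add: subs_def)

lemma card_subs: "finite x \<Longrightarrow> card (subs k x) = card x choose k"
  by (simp add: subs_def n_subsets)

lemma choose_eq_sum_subs:
  assumes "finite x"
  shows "real (card (x \<inter> z) choose k) = (\<Sum>S\<in>subs k x. of_bool (S \<subseteq> z))"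
proof -
  have "subs k (x \<inter> z) = subs k x \<inter> {S. S \<subseteq> z}"
    by (auto simp: subs_def)
  with card_subs[of "x \<inter> z" k] assms show ?thesis
    by (simp add: Int_def)
qed

text \<open>Complements turn supersets of \<open>T\<close> into subsets of \<open>V - T\<close>. The
  lower index \<open>card V - k\<close> is deliberate: with \<open>k - card T\<close> truncated
  subtraction would give 1 instead of 0 when \<open>T\<close> has more than \<open>k\<close>
  elements.\<close>

lemma sum_supersets:
  assumes "finite V" "T \<subseteq> V" "k \<le> card V"
  shows "(\<Sum>y\<in>subs k V. of_bool (T \<subseteq> y)) = real ((card V - card T) choose (card V - k))"
proof -
  have "bij_betw (\<lambda>y. V - y) (subs k V \<inter> {y. T \<subseteq> y}) (subs (card V - k) (V - T))"
  proof (rule bij_betwI[where g = "\<lambda>y. V - y"])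
    show "(\<lambda>y. V - y) \<in> subs k V \<inter> {y. T \<subseteq> y} \<rightarrow> subs (card V - k) (V - T)"
      using assms by (auto simp: subs_def card_Diff_subset finite_subset)
    show "(\<lambda>y. V - y) \<in> subs (card V - k) (V - T) \<rightarrow> subs k V \<inter> {y. T \<subseteq> y}"
    proof
      fix y assume y: "y \<in> subs (card V - k) (V - T)"
      then have "y \<subseteq> V" "card y = card V - k" by (auto simp: subs_def)
      then have "card (V - y) = k"
        using assms by (simp add: card_Diff_subset finite_subset)
      then show "V - y \<in> subs k V \<inter> {y. T \<subseteq> y}"
        using y assms by (auto simp: subs_def)
    qed
  qed (use assms in \<open>auto simp: subs_def\<close>)
  then have "card (subs k V \<inter> {y. T \<subseteq> y}) = (card V - card T) choose (card V - k)"
    using assms by (simp add: bij_betw_same_card card_subs card_Diff_subset finite_subset)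
  then show ?thesis
    using assms by (simp add: Int_def)
qed

lemma sum_rotate3:
  "(\<Sum>a\<in>A. \<Sum>b\<in>B. \<Sum>c\<in>C. g a b c) = (\<Sum>c\<in>C. \<Sum>a\<in>A. \<Sum>b\<in>B. g a b c)"
  by (rule trans[OF sum.cong[OF refl sum.swap] sum.swap])

text \<open>Forward substitution: the new unknown does not occur in the earlier rows, and the last
  row is solved for it by dividing by the diagonal entry.\<close>

lemma triangular_system:
  fixes B :: "nat \<Rightarrow> nat \<Rightarrow> real"
  assumes "\<And>k. k \<le> M \<Longrightarrow> B k k \<noteq> 0" "\<And>k j. k < j \<Longrightarrow> B k j = 0"
  shows "\<exists>u. \<forall>k\<le>M. c k = (\<Sum>j\<le>M. B k j * u j)"
  using assms(1)
proof (induction M)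
  case 0
  then show ?case by (intro exI[of _ "\<lambda>_. c 0 / B 0 0"]) simp
next
  case (Suc M)
  then obtain u where u: "\<And>k. k \<le> M \<Longrightarrow> c k = (\<Sum>j\<le>M. B k j * u j)" by auto
  define v where "v = u(Suc M := (c (Suc M) - (\<Sum>j\<le>M. B (Suc M) j * u j)) / B (Suc M) (Suc M))"
  have *: "(\<Sum>j\<le>M. B k j * v j) = (\<Sum>j\<le>M. B k j * u j)" for k
    by (rule sum.cong) (auto simp: v_def)
  have "c k = (\<Sum>j\<le>Suc M. B k j * v j)" if "k \<le> Suc M" for k
  proof (cases "k = Suc M")
    case True
    show ?thesis unfolding True sum.atMost_Suc * using Suc.prems by (simp add: v_def)
  next
    case False
    then show ?thesis using that u[of k] assms(2)[of k "Suc M"] unfolding sum.atMost_Suc * by simp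
  qed
  then show ?case by blast
qed

lemma binomial_basis:
  fixes h :: "nat \<Rightarrow> real"
  shows "\<exists>u. \<forall>m\<le>M. h m = (\<Sum>i\<le>M. u i * real (m choose i))"
  using triangular_system[of M "\<lambda>m i. real (m choose i)" h]
  by (simp add: binomial_eq_0 mult.commute)

text \<open>The kernels \<open>\<lambda>x y. card (x \<inter> y) choose k\<close> span the Bose--Mesner algebra of the Johnson scheme.\<close>

lemma binomial_kernel_mult:
  assumes "l \<le> r" "k \<le> r" "r \<le> n"
  shows "\<exists>v. \<forall>x\<in>johnson_vertices n r. \<forall>y\<in>johnson_vertices n r.
    (\<Sum>z\<in>johnson_vertices n r. real (card (x \<inter> z) choose l) * real (card (z \<inter> y) choose k))
      = (\<Sum>i\<le>r. v i * real (card (x \<inter> y) choose i))"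
proof -
  \<comment> \<open>Here \<open>m\<close> stands for \<open>card (S \<inter> T)\<close>, so that
    \<open>l + k - m\<close> is the size of \<open>S \<union> T\<close>.\<close>
  obtain h where h: "\<And>m. m \<le> r \<Longrightarrow>
      real ((n - (l + k - m)) choose (n - r)) = (\<Sum>i\<le>r. h i * real (m choose i))"
    using binomial_basis[of r "\<lambda>m. real ((n - (l + k - m)) choose (n - r))"] by blast
  \<comment> \<open>The two binomials count the sets \<open>S\<close> with
    \<open>U \<subseteq> S \<subseteq> x\<close> and the sets \<open>T\<close> with
    \<open>U \<subseteq> T \<subseteq> y\<close> for a fixed \<open>U\<close> of size
    \<open>i\<close>.\<close>
  define v where "v = (\<lambda>i. h i * real ((r - i) choose (r - l)) * real ((r - i) choose (r - k)))"
  show ?thesis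
  proof (intro exI[of _ v] ballI)
    fix x y assume "x \<in> johnson_vertices n r" "y \<in> johnson_vertices n r"
    then have x: "x \<subseteq> {1..n}" "card x = r" "finite x" and y: "y \<subseteq> {1..n}" "card y = r" "finite y"
      by (auto simp: johnson_vertices_def intro: finite_subset)
    have count: "(\<Sum>z\<in>johnson_vertices n r. of_bool (S \<subseteq> z) * of_bool (T \<subseteq> z))
        = (\<Sum>i\<le>r. h i * real (card (S \<inter> T) choose i))"
      if "S \<in> subs l x" "T \<in> subs k y" for S T
    proof -
      have ST: "S \<subseteq> x" "T \<subseteq> y" "card S = l" "card T = k" "finite S" "finite T"
        using that x y by (auto simp: subs_def intro: finite_subset)
      have "card (S \<union> T) = l + k - card (S \<inter> T)"
        using card_Un_Int[of S T] ST by simp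
      moreover have "card (S \<inter> T) \<le> r"
        using ST \<open>l \<le> r\<close> card_mono[of S "S \<inter> T"] by auto
      moreover have "(\<Sum>z\<in>johnson_vertices n r. of_bool (S \<subseteq> z) * of_bool (T \<subseteq> z))
          = (\<Sum>z\<in>subs r {1..n}. of_bool (S \<union> T \<subseteq> z) :: real)"
        unfolding johnson_vertices_subs by (rule sum.cong) auto
      moreover have "S \<union> T \<subseteq> {1..n}"
        using ST x y by blast
      ultimately show ?thesis
        using sum_supersets[of "{1..n}" "S \<union> T" r] h[of "card (S \<inter> T)"] \<open>r \<le> n\<close> by simp
    qed
    have "(\<Sum>z\<in>johnson_vertices n r. real (card (x \<inter> z) choose l) * real (card (z \<inter> y) choose k))
      = (\<Sum>z\<in>johnson_vertices n r. \<Sum>S\<in>subs l x. \<Sum>T\<in>subs k y. of_bool (S \<subseteq> z) * of_bool (T \<subseteq> z))"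
      using choose_eq_sum_subs[OF x(3)] choose_eq_sum_subs[OF y(3)]
      by (simp add: Int_commute sum_product)
    also have "\<dots> = (\<Sum>S\<in>subs l x. \<Sum>T\<in>subs k y. \<Sum>z\<in>johnson_vertices n r.
        of_bool (S \<subseteq> z) * of_bool (T \<subseteq> z))"
      by (rule sum_rotate3[symmetric])
    also have "\<dots> = (\<Sum>S\<in>subs l x. \<Sum>T\<in>subs k y. \<Sum>i\<le>r. h i * real (card (S \<inter> T) choose i))"
      using count by (intro sum.cong) auto
    also have "\<dots> = (\<Sum>i\<le>r. h i * (\<Sum>S\<in>subs l x. \<Sum>T\<in>subs k y. real (card (S \<inter> T) choose i)))"
      unfolding sum_distrib_left
      by (rule sum_rotate3)
    also have "\<dots> = (\<Sum>i\<le>r. v i * real (card (x \<inter> y) choose i))"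
    proof (rule sum.cong[OF refl])
      fix i assume "i \<in> {..r}"
      have "(\<Sum>S\<in>subs l x. \<Sum>T\<in>subs k y. real (card (S \<inter> T) choose i))
        = (\<Sum>S\<in>subs l x. \<Sum>T\<in>subs k y. \<Sum>U\<in>subs i (x \<inter> y). of_bool (U \<subseteq> S) * of_bool (U \<subseteq> T))"
      proof (intro sum.cong refl)
        fix S T assume "S \<in> subs l x" "T \<in> subs k y"
        then have "S \<inter> T = x \<inter> y \<inter> (S \<inter> T)" by (auto simp: subs_def)
        then have "real (card (S \<inter> T) choose i) = (\<Sum>U\<in>subs i (x \<inter> y). of_bool (U \<subseteq> S \<inter> T))"
          using choose_eq_sum_subs[of "x \<inter> y" "S \<inter> T" i] x by simp
        then show "real (card (S \<inter> T) choose i)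
            = (\<Sum>U\<in>subs i (x \<inter> y). of_bool (U \<subseteq> S) * of_bool (U \<subseteq> T))"
          by (simp add: of_bool_conj)
      qed
      also have "\<dots> = (\<Sum>U\<in>subs i (x \<inter> y). (\<Sum>S\<in>subs l x. of_bool (U \<subseteq> S)) * (\<Sum>T\<in>subs k y. of_bool (U \<subseteq> T)))"
        unfolding sum_product
        by (rule sum_rotate3)
      also have "\<dots> = (\<Sum>U\<in>subs i (x \<inter> y). real ((r - i) choose (r - l)) * real ((r - i) choose (r - k)))"
      proof (rule sum.cong[OF refl])
        fix U assume "U \<in> subs i (x \<inter> y)"
        then have "U \<subseteq> x" "U \<subseteq> y" "card U = i" by (auto simp: subs_def)
        then show "(\<Sum>S\<in>subs l x. of_bool (U \<subseteq> S)) * (\<Sum>T\<in>subs k y. of_bool (U \<subseteq> T))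
            = real ((r - i) choose (r - l)) * real ((r - i) choose (r - k))"
          using sum_supersets[of x U l] sum_supersets[of y U k] x y assms by simp
      qed
      also have "\<dots> = real (card (x \<inter> y) choose i) * (real ((r - i) choose (r - l)) * real ((r - i) choose (r - k)))"
        using x by (simp add: card_subs)
      finally show "h i * (\<Sum>S\<in>subs l x. \<Sum>T\<in>subs k y. real (card (S \<inter> T) choose i))
          = v i * real (card (x \<inter> y) choose i)"
        by (simp add: v_def)
    qed
    finally show "(\<Sum>z\<in>johnson_vertices n r. real (card (x \<inter> z) choose l) * real (card (z \<inter> y) choose k))
      = (\<Sum>i\<le>r. v i * real (card (x \<inter> y) choose i))" .
  qed
qed

section \<open>Common eigenvectors of the kernels\<close>

text \<open>The pairs {i, r + i} are disjoint and lie in {1..n} when 2r < n. The vertex {1..r}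
  contains exactly the first element of each pair, so the value there is 1 for every
  \<open>j\<close>.\<close>

definition pair_sign :: "nat \<Rightarrow> nat \<Rightarrow> nat set \<Rightarrow> real" where
  "pair_sign r j y = (\<Prod>i=1..j. of_bool (i \<in> y) - of_bool (r + i \<in> y))"

lemma pair_sign_0 [simp]: "pair_sign r 0 y = 1"
  by (simp add: pair_sign_def)

lemma pair_sign_Suc:
  "pair_sign r (Suc j) y = pair_sign r j y * (of_bool (Suc j \<in> y) - of_bool (r + Suc j \<in> y))"
  by (simp add: pair_sign_def)

lemma pair_sign_insert:
  assumes "j < c" "c \<le> r \<or> r + j < c"
  shows "pair_sign r j (insert c y) = pair_sign r j y" "pair_sign r j (y - {c}) = pair_sign r j y"
  using assms by (auto simp: pair_sign_def intro!: prod.cong)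

lemma pair_sign_base: "j \<le> r \<Longrightarrow> pair_sign r j {1..r} = 1"
  by (auto simp: pair_sign_def)

text \<open>A nonzero product means that \<open>x\<close> contains exactly one element of each of
  the \<open>j\<close> disjoint pairs.\<close>

lemma pair_sign_nonzero_card:
  assumes "finite x" "j \<le> r" "pair_sign r j x \<noteq> 0"
  shows "j \<le> card x"
  using assms
proof (induction j arbitrary: x)
  case (Suc j)
  then obtain e where e: "e \<in> x" "e = Suc j \<or> e = r + Suc j" "pair_sign r j x \<noteq> 0"
    by (cases "Suc j \<in> x"; cases "r + Suc j \<in> x") (auto simp: pair_sign_Suc)
  then have "pair_sign r j (x - {e}) \<noteq> 0"
    using Suc.prems by (auto simp: pair_sign_insert)
  then have "j \<le> card (x - {e})"
    using Suc.IH[of "x - {e}"] Suc.prems by simp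
  moreover have "0 < card x"
    using e Suc.prems by (auto simp: card_gt_0_iff)
  ultimately show ?case using e Suc.prems by simp
qed simp

text \<open>Splitting off the last pair turns the sum into the difference of two sums over
  supersets, of \<open>T\<close> with one or the other element of the pair added. They cancel if
  \<open>T\<close> contains both or neither; otherwise Pascal's rule gives the factor.\<close>

lemma pair_sign_sum_up:
  assumes "2 * r < n" "j \<le> r" "T \<subseteq> {1..n}"
  shows "(\<Sum>y\<in>johnson_vertices n r. of_bool (T \<subseteq> y) * pair_sign r j y)
    = pair_sign r j T * real ((n - card T - j) choose (n - r - j))"
  using assms(2,3)
proof (induction j arbitrary: T)
  case 0
  then show ?case
    using sum_supersets[of "{1..n}" T r] assms(1) by (simp add: johnson_vertices_subs)
next
  case (Suc j)
  let ?a = "Suc j" and ?b = "r + Suc j" and ?X = "johnson_vertices n r"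
  define c where "c = (\<lambda>m. real ((n - m - j) choose (n - r - j)))"
  have fin: "finite T" using Suc.prems finite_subset by blast
  have ins: "insert ?a T \<subseteq> {1..n}" "insert ?b T \<subseteq> {1..n}"
    using Suc.prems assms(1) by auto
  have "(\<Sum>y\<in>?X. of_bool (T \<subseteq> y) * pair_sign r ?a y)
    = (\<Sum>y\<in>?X. of_bool (insert ?a T \<subseteq> y) * pair_sign r j y)
      - (\<Sum>y\<in>?X. of_bool (insert ?b T \<subseteq> y) * pair_sign r j y)"
    unfolding sum_subtractf[symmetric] by (rule sum.cong) (auto simp: pair_sign_Suc)
  also have "\<dots> = pair_sign r j T * (c (card (insert ?a T)) - c (card (insert ?b T)))"
    using Suc.IH[OF _ ins(1)] Suc.IH[OF _ ins(2)] Suc.prems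
    by (simp add: pair_sign_insert c_def right_diff_distrib)
  also have "\<dots> = pair_sign r ?a T * real ((n - card T - ?a) choose (n - r - ?a))"
  proof (cases "(?a \<in> T) = (?b \<in> T)")
    case True
    then show ?thesis using fin by (auto simp: pair_sign_Suc card_insert_if)
  next
    case False
    have "c (card T) - c (Suc (card T)) = real ((n - card T - ?a) choose (n - r - ?a))"
    proof (cases "card T \<le> r")
      case True
      define p q where "p = n - card T - ?a" and "q = n - r - ?a"
      have "n - card T - j = Suc p" "n - Suc (card T) - j = p" "n - r - j = Suc q"
        using True assms(1) Suc.prems by (auto simp: p_def q_def)
      then show ?thesis unfolding c_def p_def[symmetric] q_def[symmetric] by simp
    next
      \<comment> \<open>A set \<open>T\<close> larger than a vertex has no superset among the
        vertices, and the complementary form of the binomials makes all three of them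
        vanish.\<close>
      case False
      then have "n - card T - j < n - r - j" "n - Suc (card T) - j < n - r - j"
        "n - card T - ?a < n - r - ?a"
        using assms(1) Suc.prems by linarith+
      then show ?thesis unfolding c_def by (simp only: binomial_eq_0)
    qed
    with False show ?thesis using fin by (auto simp: pair_sign_Suc card_insert_if algebra_simps)
  qed
  finally show ?case .
qed

text \<open>Dual to the sum over supersets: the difference of two membership indicators is rewritten
  as a difference of non-membership indicators, so the induction hypothesis applies to
  \<open>x\<close> with one element removed. The guard keeps truncated differences from producing
  spurious ones.\<close>

lemma pair_sign_sum_down:
  assumes "finite x" "j \<le> r"
  shows "(\<Sum>T\<in>subs k x. pair_sign r j T)
    = pair_sign r j x * (if j \<le> k \<and> k \<le> card x then real ((card x - j) choose (k - j)) else 0)"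
  using assms
proof (induction j arbitrary: x)
  case 0
  then show ?case by (simp add: card_subs)
next
  case (Suc j)
  let ?a = "Suc j" and ?b = "r + Suc j"
  define c where "c = (\<lambda>m. if j \<le> k \<and> k \<le> m then real ((m - j) choose (k - j)) else 0)"
  have rm: "(\<Sum>T\<in>subs k (x - {e}). pair_sign r j T) = (\<Sum>T\<in>subs k x. of_bool (e \<notin> T) * pair_sign r j T)" for e
  proof -
    have "subs k (x - {e}) = subs k x \<inter> {T. e \<notin> T}" by (auto simp: subs_def)
    moreover have "(\<Sum>T\<in>subs k x. of_bool (e \<notin> T) * pair_sign r j T)
        = (\<Sum>T\<in>subs k x. if T \<in> {T. e \<notin> T} then pair_sign r j T else 0)"
      by (rule sum.cong) auto
    ultimately show ?thesis
      using Suc.prems by (simp add: sum.inter_restrict)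
  qed
  have "(\<Sum>T\<in>subs k x. pair_sign r ?a T)
    = (\<Sum>T\<in>subs k (x - {?b}). pair_sign r j T) - (\<Sum>T\<in>subs k (x - {?a}). pair_sign r j T)"
    unfolding rm sum_subtractf[symmetric] by (rule sum.cong) (auto simp: pair_sign_Suc)
  also have "\<dots> = pair_sign r j x * (c (card (x - {?b})) - c (card (x - {?a})))"
    using Suc.IH[of "x - {?a}"] Suc.IH[of "x - {?b}"] Suc.prems
    by (simp add: pair_sign_insert c_def right_diff_distrib)
  also have "\<dots> = pair_sign r ?a x * (if ?a \<le> k \<and> k \<le> card x then real ((card x - ?a) choose (k - ?a)) else 0)"
  proof (cases "(?a \<in> x) = (?b \<in> x)")
    case True
    then show ?thesis using Suc.prems by (auto simp: pair_sign_Suc card_Diff_singleton_if)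
  next
    case False
    show ?thesis
    proof (cases "pair_sign r ?a x = 0")
      case True
      then show ?thesis using False by (auto simp: pair_sign_Suc)
    next
      case nz: False
      \<comment> \<open>Needed when \<open>k = j\<close>: both binomials must then equal 1 and
        cancel, which requires \<open>j \<le> card x - 1\<close>.\<close>
      then have "?a \<le> card x" using pair_sign_nonzero_card[of x ?a r] Suc.prems by simp
      have "c (card x) - c (card x - 1)
        = (if ?a \<le> k \<and> k \<le> card x then real ((card x - ?a) choose (k - ?a)) else 0)"
      proof (cases "?a \<le> k \<and> k \<le> card x")
        case True
        define p q where "p = card x - ?a" and "q = k - ?a"
        have "card x - j = Suc p" "card x - 1 - j = p" "k - j = Suc q" "q \<le> p" "k \<le> card x - 1 \<longleftrightarrow> q < p"
          using True by (auto simp: p_def q_def)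
        then show ?thesis using True by (auto simp: c_def p_def[symmetric] q_def[symmetric])
      next
        case False
        then consider "k < j" | "k = j" | "card x < k" by linarith
        then show ?thesis
          using False \<open>?a \<le> card x\<close> by cases (auto simp: c_def)
      qed
      with False show ?thesis using Suc.prems by (auto simp: pair_sign_Suc card_Diff_singleton_if algebra_simps)
    qed
  qed
  finally show ?case .
qed

definition kernel_eigenvalue :: "nat \<Rightarrow> nat \<Rightarrow> nat \<Rightarrow> nat \<Rightarrow> real" where
  "kernel_eigenvalue n r k j =
    (if j \<le> k then real ((r - j) choose (k - j)) * real ((n - k - j) choose (r - k)) else 0)"

text \<open>The kernel is the inclusion matrix between k-sets and vertices times its transpose, so
  the eigenvalue is the product of the factors of the upward and the downward sum.\<close>

lemma kernel_eigenvector: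
  assumes "2 * r < n" "j \<le> r" "k \<le> r" "x \<in> johnson_vertices n r"
  shows "(\<Sum>y\<in>johnson_vertices n r. real (card (x \<inter> y) choose k) * pair_sign r j y)
    = kernel_eigenvalue n r k j * pair_sign r j x"
proof -
  have x: "x \<subseteq> {1..n}" "card x = r" "finite x"
    using assms(4) by (auto simp: johnson_vertices_def intro: finite_subset)
  have "(\<Sum>y\<in>johnson_vertices n r. real (card (x \<inter> y) choose k) * pair_sign r j y)
    = (\<Sum>T\<in>subs k x. \<Sum>y\<in>johnson_vertices n r. of_bool (T \<subseteq> y) * pair_sign r j y)"
    by (simp only: choose_eq_sum_subs[OF x(3)] sum_distrib_right, rule sum.swap)
  also have "\<dots> = (\<Sum>T\<in>subs k x. pair_sign r j T * real ((n - k - j) choose (n - r - j)))"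
  proof (rule sum.cong[OF refl])
    fix T assume "T \<in> subs k x"
    then have "T \<subseteq> {1..n}" "card T = k" using x by (auto simp: subs_def)
    then show "(\<Sum>y\<in>johnson_vertices n r. of_bool (T \<subseteq> y) * pair_sign r j y)
        = pair_sign r j T * real ((n - k - j) choose (n - r - j))"
      using pair_sign_sum_up[OF assms(1,2)] by blast
  qed
  also have "\<dots> = pair_sign r j x * (if j \<le> k \<and> k \<le> card x then real ((card x - j) choose (k - j)) else 0)
      * real ((n - k - j) choose (n - r - j))"
    by (simp add: sum_distrib_right[symmetric] pair_sign_sum_down[OF x(3) assms(2)])
  also have "(n - k - j) choose (n - r - j) = (n - k - j) choose (r - k)"
    using assms binomial_symmetric[of "r - k" "n - k - j"] by (simp add: add.commute)
  finally show ?thesis using x assms by (simp add: kernel_eigenvalue_def)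
qed

section \<open>Closed walks\<close>

text \<open>Evaluating at m = 0, 1, ..., s in turn determines the coefficients up to
  \<open>s\<close>. That they start with 1 at \<open>s\<close> is what later makes the kernel with
  \<open>k = s\<close> the leading term of the adjacency matrix.\<close>

lemma indicator_binomial_basis:
  assumes "s \<le> r"
  shows "\<exists>\<alpha>::nat \<Rightarrow> real. (\<forall>k<s. \<alpha> k = 0) \<and> \<alpha> s = 1 \<and>
    (\<forall>m\<le>r. of_bool (m = s) = (\<Sum>k\<le>r. \<alpha> k * real (m choose k)))"
proof -
  obtain \<alpha> :: "nat \<Rightarrow> real" where \<alpha>:
    "\<And>m. m \<le> r \<Longrightarrow> of_bool (m = s) = (\<Sum>k\<le>r. \<alpha> k * real (m choose k))"
    using binomial_basis[of r "\<lambda>m. of_bool (m = s)"] by blast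
  have diag: "of_bool (m = s) = \<alpha> m" if "m \<le> r" "\<And>k. k < m \<Longrightarrow> \<alpha> k = 0" for m
  proof -
    have "(\<Sum>k\<le>r. \<alpha> k * real (m choose k)) = (\<Sum>k\<le>r. if k = m then \<alpha> m else 0)"
    proof (rule sum.cong[OF refl])
      fix k show "\<alpha> k * real (m choose k) = (if k = m then \<alpha> m else 0)"
        using that(2)[of k] binomial_eq_0[of m k] by (cases k m rule: linorder_cases) auto
    qed
    then show ?thesis using \<alpha>[OF that(1)] that(1) by simp
  qed
  have zero: "\<alpha> k = 0" if "k < s" for k
    using that
  proof (induction k rule: less_induct)
    case (less k)
    then have "of_bool (k = s) = \<alpha> k" using assms by (intro diag) auto
    with less show ?case by simp
  qed
  moreover have "\<alpha> s = 1" using diag[of s] zero assms by simp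
  ultimately show ?thesis using \<alpha> by blast
qed

section \<open>Walk counts as matrix powers\<close>

fun walks :: "nat \<Rightarrow> nat \<Rightarrow> nat \<Rightarrow> nat \<Rightarrow> nat set \<Rightarrow> nat set \<Rightarrow> real" where
  "walks n r s 0 x y = of_bool (x = y)"
| "walks n r s (Suc t) x y =
    (\<Sum>z\<in>johnson_vertices n r. of_bool (card (x \<inter> z) = s) * walks n r s t z y)"

lemma finite_johnson_vertices [simp]: "finite (johnson_vertices n r)"
  by (simp add: johnson_vertices_subs)

lemma card_johnson_vertices: "card (johnson_vertices n r) = n choose r"
  by (simp add: johnson_vertices_subs card_subs)

lemma johnson_adj_iff:
  assumes "s < r" "x \<in> johnson_vertices n r"
  shows "johnson_adj s x y \<longleftrightarrow> card (x \<inter> y) = s"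
  using assms by (auto simp: johnson_adj_def johnson_vertices_def)

text \<open>Only the first \<open>t\<close> vertices are stored, so that a closed walk is a list of
  length \<open>t\<close> as in the encoding of cycle homomorphisms. Indexing into
  \<open>xs @ [y]\<close> covers the last step, and for \<open>t = 0\<close> it forces
  \<open>x = y\<close>.\<close>

definition walk_lists :: "nat \<Rightarrow> nat \<Rightarrow> nat \<Rightarrow> nat \<Rightarrow> nat set \<Rightarrow> nat set \<Rightarrow> nat set list set" where
  "walk_lists n r s t x y = {xs. length xs = t \<and> set xs \<subseteq> johnson_vertices n r \<and> (xs @ [y]) ! 0 = x \<and>
    (\<forall>i<t. johnson_adj s (xs ! i) ((xs @ [y]) ! Suc i))}"

lemma finite_walk_lists: "finite (walk_lists n r s t x y)"
  by (rule finite_subset[OF _ finite_lists_length_eq[OF finite_johnson_vertices[of n r], of t]])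
     (auto simp: walk_lists_def)

lemma walk_lists_Suc:
  assumes "x \<in> johnson_vertices n r" "y \<in> johnson_vertices n r"
  shows "walk_lists n r s (Suc t) x y
    = (#) x ` (\<Union>z\<in>{z\<in>johnson_vertices n r. johnson_adj s x z}. walk_lists n r s t z y)"
proof (intro equalityI subsetI)
  fix xs assume xs: "xs \<in> walk_lists n r s (Suc t) x y"
  then obtain xs' where xs': "xs = x # xs'" by (cases xs) (auto simp: walk_lists_def)
  have "xs' \<in> walk_lists n r s t ((xs' @ [y]) ! 0) y"
    using xs by (auto simp: walk_lists_def xs' All_less_Suc2)
  moreover have "(xs' @ [y]) ! 0 \<in> johnson_vertices n r"
    using xs assms(2) by (cases xs') (auto simp: walk_lists_def xs')
  moreover have "johnson_adj s x ((xs' @ [y]) ! 0)"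
    using xs by (auto simp: walk_lists_def xs' All_less_Suc2)
  ultimately show "xs \<in> (#) x ` (\<Union>z\<in>{z\<in>johnson_vertices n r. johnson_adj s x z}. walk_lists n r s t z y)"
    unfolding xs' by blast
next
  fix xs assume "xs \<in> (#) x ` (\<Union>z\<in>{z\<in>johnson_vertices n r. johnson_adj s x z}. walk_lists n r s t z y)"
  then show "xs \<in> walk_lists n r s (Suc t) x y"
    using assms by (auto simp: walk_lists_def All_less_Suc2)
qed

lemma card_walk_lists:
  assumes "s < r" "x \<in> johnson_vertices n r" "y \<in> johnson_vertices n r"
  shows "real (card (walk_lists n r s t x y)) = walks n r s t x y"
  using assms(2)
proof (induction t arbitrary: x)
  case 0
  have "walk_lists n r s 0 x y = (if x = y then {[]} else {})"
    by (auto simp: walk_lists_def)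
  then show ?case by simp
next
  case (Suc t)
  let ?Z = "{z\<in>johnson_vertices n r. johnson_adj s x z}"
  have "card (walk_lists n r s (Suc t) x y) = card (\<Union>z\<in>?Z. walk_lists n r s t z y)"
    unfolding walk_lists_Suc[OF Suc.prems assms(3)] by (rule card_image) simp
  also have "\<dots> = (\<Sum>z\<in>?Z. card (walk_lists n r s t z y))"
    by (rule card_UN_disjoint) (auto simp: finite_walk_lists, auto simp: walk_lists_def)
  also have "real \<dots> = (\<Sum>z\<in>?Z. walks n r s t z y)"
    using Suc.IH by simp
  also have "\<dots> = walks n r s (Suc t) x y"
    by (simp add: sum.inter_filter johnson_adj_iff[OF assms(1) Suc.prems] of_bool_def if_distrib if_distribR cong: if_cong)
  finally show ?case .
qed

lemma hom_cycle_walks: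
  assumes "s < r" "1 \<le> t"
  shows "real (hom_cycle_johnson t n r s) = (\<Sum>x\<in>johnson_vertices n r. walks n r s t x x)"
proof -
  let ?X = "johnson_vertices n r"
  \<comment> \<open>The wrap-around of the index modulo \<open>t\<close> is the same as repeating
    the first vertex at the end.\<close>
  have step: "(xs @ [xs ! 0]) ! Suc i = xs ! ((i + 1) mod t)" if "length xs = t" "i < t" for xs :: "nat set list" and i
    using that by (cases "Suc i = t") (auto simp: nth_append)
  have "{xs. length xs = t \<and> set xs \<subseteq> ?X \<and> (\<forall>i<t. johnson_adj s (xs ! i) (xs ! ((i + 1) mod t)))}
    = (\<Union>x\<in>?X. walk_lists n r s t x x)" (is "?L = ?R")
  proof (intro equalityI subsetI)
    fix xs assume xs: "xs \<in> ?L"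
    then have len: "length xs = t" by simp
    then have "xs ! 0 \<in> set xs" using assms(2) by simp
    then have "xs ! 0 \<in> ?X" using xs by blast
    moreover have "xs \<in> walk_lists n r s t (xs ! 0) (xs ! 0)"
      using xs assms(2) step[OF len] by (auto simp: walk_lists_def nth_append)
    ultimately show "xs \<in> ?R" by blast
  next
    fix xs assume "xs \<in> ?R"
    then obtain x where x: "xs \<in> walk_lists n r s t x x" by blast
    then have len: "length xs = t" by (simp add: walk_lists_def)
    then have "x = xs ! 0" using x assms(2) by (cases xs) (auto simp: walk_lists_def)
    then show "xs \<in> ?L" using x step[OF len] by (auto simp: walk_lists_def)
  qed
  then have "hom_cycle_johnson t n r s = card (\<Union>x\<in>?X. walk_lists n r s t x x)"
    by (simp add: hom_cycle_johnson_def)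
  also have "\<dots> = (\<Sum>x\<in>?X. card (walk_lists n r s t x x))"
  proof (rule card_UN_disjoint)
    \<comment> \<open>Since \<open>t \<ge> 1\<close>, the starting vertex can be read off as the
      head of the list.\<close>
    show "\<forall>x\<in>?X. \<forall>y\<in>?X. x \<noteq> y \<longrightarrow> walk_lists n r s t x x \<inter> walk_lists n r s t y y = {}"
      using assms(2) by (auto simp: walk_lists_def nth_append)
  qed (auto simp: finite_walk_lists)
  also have "real \<dots> = (\<Sum>x\<in>?X. walks n r s t x x)"
    using card_walk_lists[OF assms(1)] by simp
  finally show ?thesis .
qed

lemma johnson_degree:
  assumes "s \<le> r" "x \<in> johnson_vertices n r"
  shows "(\<Sum>z\<in>johnson_vertices n r. of_bool (card (x \<inter> z) = s)) = real (johnson_N1 n r s)"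
proof -
  have x: "x \<subseteq> {1..n}" "card x = r" "finite x"
    using assms(2) by (auto simp: johnson_vertices_def intro: finite_subset)
  have split: "card z = card (x \<inter> z) + card (z - x)" if "finite z" for z
    using card_Int_Diff[OF that, of x] by (simp add: Int_commute)
  have "bij_betw (\<lambda>z. (x \<inter> z, z - x)) {z\<in>johnson_vertices n r. card (x \<inter> z) = s}
      (subs s x \<times> subs (r - s) ({1..n} - x))"
  proof (rule bij_betwI[where g = "\<lambda>(S, T). S \<union> T"])
    show "(\<lambda>z. (x \<inter> z, z - x)) \<in> {z\<in>johnson_vertices n r. card (x \<inter> z) = s}
      \<rightarrow> subs s x \<times> subs (r - s) ({1..n} - x)"
    proof
      fix z assume z: "z \<in> {z\<in>johnson_vertices n r. card (x \<inter> z) = s}"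
      then have "finite z" by (auto simp: johnson_vertices_def intro: finite_subset)
      from split[OF this] z show "(x \<inter> z, z - x) \<in> subs s x \<times> subs (r - s) ({1..n} - x)"
        by (auto simp: johnson_vertices_def subs_def)
    qed
    show "(\<lambda>(S, T). S \<union> T) \<in> subs s x \<times> subs (r - s) ({1..n} - x)
      \<rightarrow> {z\<in>johnson_vertices n r. card (x \<inter> z) = s}"
    proof clarify
      fix S T assume ST: "S \<in> subs s x" "T \<in> subs (r - s) ({1..n} - x)"
      then have "finite S" "finite T" "S \<inter> T = {}" "x \<inter> (S \<union> T) = S"
        using x by (auto simp: subs_def intro: finite_subset)
      then show "S \<union> T \<in> johnson_vertices n r \<and> card (x \<inter> (S \<union> T)) = s"
        using ST x assms(1) by (auto simp: johnson_vertices_def subs_def card_Un_disjoint)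
    qed
  qed (auto simp: subs_def)
  then have "card {z\<in>johnson_vertices n r. card (x \<inter> z) = s} = johnson_N1 n r s"
    using x by (simp add: bij_betw_same_card card_cartesian_product card_subs card_Diff_subset johnson_N1_def)
  then show ?thesis by (simp add: Int_def)
qed

lemma walks_nonneg: "0 \<le> walks n r s t x y"
  by (induction t arbitrary: x) (auto intro!: sum_nonneg)

lemma walks_row_sum:
  assumes "s \<le> r" "x \<in> johnson_vertices n r"
  shows "(\<Sum>y\<in>johnson_vertices n r. walks n r s t x y) = real (johnson_N1 n r s) ^ t"
  using assms(2)
proof (induction t arbitrary: x)
  case (Suc t)
  have "(\<Sum>y\<in>johnson_vertices n r. walks n r s (Suc t) x y)
    = (\<Sum>z\<in>johnson_vertices n r. of_bool (card (x \<inter> z) = s) * (\<Sum>y\<in>johnson_vertices n r. walks n r s t z y))"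
    unfolding walks.simps sum_distrib_left by (rule sum.swap)
  also have "\<dots> = (\<Sum>z\<in>johnson_vertices n r. of_bool (card (x \<inter> z) = s)) * real (johnson_N1 n r s) ^ t"
    unfolding sum_distrib_right using Suc.IH by (intro sum.cong) auto
  finally show ?case using johnson_degree[OF assms(1) Suc.prems] by simp
qed (simp add: of_bool_def)

text \<open>A diagonal entry of the power is at most its row sum. The bound holds for every
  \<open>n\<close>, so it serves the finitely many \<open>n\<close> outside the asymptotic range; it
  also shows that the count vanishes whenever the degree does.\<close>

lemma hom_cycle_le:
  assumes "s < r" "1 \<le> t"
  shows "real (hom_cycle_johnson t n r s) \<le> real (n choose r) * real (johnson_N1 n r s) ^ t"
proof -
  have "walks n r s t x x \<le> real (johnson_N1 n r s) ^ t" if "x \<in> johnson_vertices n r" for x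
    using member_le_sum[of x "johnson_vertices n r" "walks n r s t x"] that
      walks_row_sum[of s r x n t] assms(1) by (simp add: walks_nonneg)
  then have "(\<Sum>x\<in>johnson_vertices n r. walks n r s t x x)
      \<le> (\<Sum>x\<in>johnson_vertices n r. real (johnson_N1 n r s) ^ t)"
    by (rule sum_mono)
  then show ?thesis by (simp add: hom_cycle_walks[OF assms] card_johnson_vertices)
qed

section \<open>The trace formula\<close>

context
  fixes r s :: nat and \<alpha> :: "nat \<Rightarrow> real"
  assumes indicator: "\<And>m. m \<le> r \<Longrightarrow> of_bool (m = s) = (\<Sum>k\<le>r. \<alpha> k * real (m choose k))"
begin

lemma adjacency_binomial:
  assumes "x \<in> johnson_vertices n r"
  shows "of_bool (card (x \<inter> z) = s) = (\<Sum>k\<le>r. \<alpha> k * real (card (x \<inter> z) choose k))"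
proof (rule indicator)
  have "finite x" using assms by (auto simp: johnson_vertices_def intro: finite_subset)
  then show "card (x \<inter> z) \<le> r"
    using assms card_mono[of x "x \<inter> z"] by (auto simp: johnson_vertices_def)
qed

lemma walks_eigenvector:
  assumes "2 * r < n" "j \<le> r" "x \<in> johnson_vertices n r"
  shows "(\<Sum>y\<in>johnson_vertices n r. walks n r s t x y * pair_sign r j y)
    = (\<Sum>k\<le>r. \<alpha> k * kernel_eigenvalue n r k j) ^ t * pair_sign r j x"
  using assms(3)
proof (induction t arbitrary: x)
  case 0
  have "(\<Sum>y\<in>johnson_vertices n r. walks n r s 0 x y * pair_sign r j y)
      = (\<Sum>y\<in>johnson_vertices n r. if y = x then pair_sign r j x else 0)"
    by (rule sum.cong) auto
  with 0 show ?case by simp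
next
  case (Suc t)
  let ?X = "johnson_vertices n r" and ?L = "\<Sum>k\<le>r. \<alpha> k * kernel_eigenvalue n r k j"
  have "(\<Sum>y\<in>?X. walks n r s (Suc t) x y * pair_sign r j y)
    = (\<Sum>z\<in>?X. of_bool (card (x \<inter> z) = s) * (\<Sum>y\<in>?X. walks n r s t z y * pair_sign r j y))"
    unfolding walks.simps sum_distrib_left sum_distrib_right mult.assoc by (rule sum.swap)
  also have "\<dots> = ?L ^ t * (\<Sum>z\<in>?X. of_bool (card (x \<inter> z) = s) * pair_sign r j z)"
    unfolding sum_distrib_left using Suc.IH by (intro sum.cong) auto
  also have "(\<Sum>z\<in>?X. of_bool (card (x \<inter> z) = s) * pair_sign r j z)
    = (\<Sum>k\<le>r. \<alpha> k * (\<Sum>z\<in>?X. real (card (x \<inter> z) choose k) * pair_sign r j z))"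
    unfolding adjacency_binomial[OF Suc.prems] sum_distrib_left sum_distrib_right mult.assoc
    by (rule sum.swap)
  also have "\<dots> = ?L * pair_sign r j x"
    unfolding sum_distrib_right
    using kernel_eigenvector[OF assms(1,2) _ Suc.prems] by (intro sum.cong) auto
  finally show ?case by simp
qed

text \<open>The identity matrix is the kernel with \<open>k = r\<close>, since two r-sets meet in r
  elements only if they are equal; each further step multiplies by a combination of kernels and
  stays in their span.\<close>

lemma walks_binomial_kernel:
  assumes "r \<le> n"
  shows "\<exists>u. \<forall>x\<in>johnson_vertices n r. \<forall>y\<in>johnson_vertices n r.
    walks n r s t x y = (\<Sum>i\<le>r. u i * real (card (x \<inter> y) choose i))"
proof (induction t)
  case 0
  show ?case
  proof (intro exI[of _ "\<lambda>i. of_bool (i = r)"] ballI)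
    fix x y assume "x \<in> johnson_vertices n r" "y \<in> johnson_vertices n r"
    then have xy: "finite x" "finite y" "card x = r" "card y = r"
      by (auto simp: johnson_vertices_def intro: finite_subset)
    have "(\<Sum>i\<le>r. of_bool (i = r) * real (card (x \<inter> y) choose i))
        = (\<Sum>i\<le>r. if i = r then real (card (x \<inter> y) choose r) else 0)"
      by (rule sum.cong) auto
    also have "\<dots> = real (card (x \<inter> y) choose r)" by simp
    also have "\<dots> = of_bool (x = y)"
    proof (cases "x = y")
      case False
      then have "\<not> x \<subseteq> y" using card_subset_eq[OF xy(2), of x] xy by metis
      then have "x \<inter> y \<subset> x" by auto
      then have "card (x \<inter> y) < r" using psubset_card_mono[OF xy(1)] xy(3) by metis
      with False show ?thesis by simp
    qed (use xy in simp)
    finally show "walks n r s 0 x y = (\<Sum>i\<le>r. of_bool (i = r) * real (card (x \<inter> y) choose i))"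
      by simp
  qed
next
  case (Suc t)
  let ?X = "johnson_vertices n r"
  obtain u where u: "\<And>x y. x \<in> ?X \<Longrightarrow> y \<in> ?X \<Longrightarrow>
      walks n r s t x y = (\<Sum>k\<le>r. u k * real (card (x \<inter> y) choose k))"
    using Suc.IH by blast
  \<comment> \<open>Quantifying over the vertices inside \<open>P\<close> makes the chosen structure
    constants independent of \<open>x\<close> and \<open>y\<close>.\<close>
  define P where "P = (\<lambda>l k v. \<forall>x\<in>?X. \<forall>y\<in>?X.
    (\<Sum>z\<in>?X. real (card (x \<inter> z) choose l) * real (card (z \<inter> y) choose k))
      = (\<Sum>i\<le>r. v i * real (card (x \<inter> y) choose i)))"
  define v where "v = (\<lambda>l k. SOME v. P l k v)"
  have ex: "\<exists>v. P l k v" if "l \<le> r" "k \<le> r" for l k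
    unfolding P_def by (rule binomial_kernel_mult[OF that assms])
  have Pv: "P l k (v l k)" if "l \<le> r" "k \<le> r" for l k
    unfolding v_def by (rule someI_ex[OF ex[OF that]])
  have v: "(\<Sum>z\<in>?X. real (card (x \<inter> z) choose l) * real (card (z \<inter> y) choose k))
      = (\<Sum>i\<le>r. v l k i * real (card (x \<inter> y) choose i))"
    if "l \<le> r" "k \<le> r" "x \<in> ?X" "y \<in> ?X" for l k x y
    using Pv[OF that(1,2), unfolded P_def, rule_format, OF that(3,4)] .
  show ?case
  proof (intro exI[of _ "\<lambda>i. \<Sum>l\<le>r. \<Sum>k\<le>r. \<alpha> l * u k * v l k i"] ballI)
    fix x y assume xy: "x \<in> ?X" "y \<in> ?X"
    have "walks n r s (Suc t) x y = (\<Sum>z\<in>?X. \<Sum>l\<le>r. \<Sum>k\<le>r.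
        \<alpha> l * u k * (real (card (x \<inter> z) choose l) * real (card (z \<inter> y) choose k)))"
      unfolding walks.simps
    proof (rule sum.cong[OF refl])
      fix z assume "z \<in> ?X"
      then show "of_bool (card (x \<inter> z) = s) * walks n r s t z y = (\<Sum>l\<le>r. \<Sum>k\<le>r.
        \<alpha> l * u k * (real (card (x \<inter> z) choose l) * real (card (z \<inter> y) choose k)))"
        unfolding adjacency_binomial[OF xy(1)] u[OF \<open>z \<in> ?X\<close> xy(2)] sum_product
        by (intro sum.cong) auto
    qed
    also have "\<dots> = (\<Sum>l\<le>r. \<Sum>k\<le>r. \<alpha> l * u k *
        (\<Sum>z\<in>?X. real (card (x \<inter> z) choose l) * real (card (z \<inter> y) choose k)))"
      unfolding sum_distrib_left by (rule sum_rotate3[symmetric])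
    also have "\<dots> = (\<Sum>l\<le>r. \<Sum>k\<le>r. \<Sum>i\<le>r. \<alpha> l * u k * v l k i * real (card (x \<inter> y) choose i))"
      by (intro sum.cong refl) (simp add: v xy sum_distrib_left mult.assoc)
    also have "\<dots> = (\<Sum>i\<le>r. (\<Sum>l\<le>r. \<Sum>k\<le>r. \<alpha> l * u k * v l k i) * real (card (x \<inter> y) choose i))"
      unfolding sum_distrib_right by (rule sum_rotate3)
    finally show "walks n r s (Suc t) x y
      = (\<Sum>i\<le>r. (\<Sum>l\<le>r. \<Sum>k\<le>r. \<alpha> l * u k * v l k i) * real (card (x \<inter> y) choose i))" .
  qed
qed

text \<open>The weights \<open>m j\<close> are the multiplicities of the eigenspaces; they are characterised here by
  the traces of the binomial kernels alone.\<close>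

lemma hom_cycle_spectral:
  assumes "s < r" "2 * r < n" "1 \<le> t"
    and m: "\<And>k. k \<le> r \<Longrightarrow>
      real (n choose r) * real (r choose k) = (\<Sum>j\<le>r. kernel_eigenvalue n r k j * m j)"
  shows "real (hom_cycle_johnson t n r s)
    = (\<Sum>j\<le>r. m j * (\<Sum>k\<le>r. \<alpha> k * kernel_eigenvalue n r k j) ^ t)"
proof -
  let ?X = "johnson_vertices n r"
  obtain u where u: "\<And>x y. x \<in> ?X \<Longrightarrow> y \<in> ?X \<Longrightarrow>
      walks n r s t x y = (\<Sum>i\<le>r. u i * real (card (x \<inter> y) choose i))"
    using walks_binomial_kernel[of n t] assms(2) by auto
  have x0: "{1..r} \<in> ?X" using assms(2) by (auto simp: johnson_vertices_def)
  \<comment> \<open>Both sides are the eigenvalue of the same matrix, once as a combination of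
    kernels and once as a power. Evaluating at {1..r}, where the eigenvector is 1, avoids any
    cancellation.\<close>
  have eig: "(\<Sum>i\<le>r. u i * kernel_eigenvalue n r i j) = (\<Sum>k\<le>r. \<alpha> k * kernel_eigenvalue n r k j) ^ t"
    if "j \<le> r" for j
  proof -
    have "(\<Sum>k\<le>r. \<alpha> k * kernel_eigenvalue n r k j) ^ t
      = (\<Sum>y\<in>?X. walks n r s t {1..r} y * pair_sign r j y)"
      using walks_eigenvector[OF assms(2) that x0, of t] unfolding pair_sign_base[OF that] by simp
    also have "\<dots> = (\<Sum>y\<in>?X. \<Sum>i\<le>r. u i * (real (card ({1..r} \<inter> y) choose i) * pair_sign r j y))"
      using u[OF x0] by (simp add: sum_distrib_right mult.assoc)
    also have "\<dots> = (\<Sum>i\<le>r. u i * (\<Sum>y\<in>?X. real (card ({1..r} \<inter> y) choose i) * pair_sign r j y))"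
      unfolding sum_distrib_left by (rule sum.swap)
    also have "\<dots> = (\<Sum>i\<le>r. u i * kernel_eigenvalue n r i j)"
    proof (rule sum.cong[OF refl])
      fix i assume "i \<in> {..r}"
      then show "u i * (\<Sum>y\<in>?X. real (card ({1..r} \<inter> y) choose i) * pair_sign r j y)
          = u i * kernel_eigenvalue n r i j"
        using kernel_eigenvector[OF assms(2) that _ x0, of i] unfolding pair_sign_base[OF that] by simp
    qed
    finally show ?thesis by simp
  qed
  \<comment> \<open>On the diagonal \<open>card (x \<inter> x) = r\<close>, so each kernel has
    constant diagonal \<open>r choose i\<close>, and its trace is the left side of the system for
    \<open>m\<close>.\<close>
  have "real (hom_cycle_johnson t n r s) = (\<Sum>x\<in>?X. \<Sum>i\<le>r. u i * real (r choose i))"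
    unfolding hom_cycle_walks[OF assms(1,3)]
    by (rule sum.cong[OF refl]) (simp add: u, simp add: johnson_vertices_def)
  also have "\<dots> = (\<Sum>i\<le>r. u i * (\<Sum>j\<le>r. kernel_eigenvalue n r i j * m j))"
    by (simp add: card_johnson_vertices sum_distrib_left[of "real (n choose r)"] m[symmetric] mult.left_commute)
  also have "\<dots> = (\<Sum>j\<le>r. m j * (\<Sum>i\<le>r. u i * kernel_eigenvalue n r i j))"
    unfolding sum_distrib_left by (subst sum.swap) (simp only: mult_ac)
  also have "\<dots> = (\<Sum>j\<le>r. m j * (\<Sum>k\<le>r. \<alpha> k * kernel_eigenvalue n r k j) ^ t)"
    by (simp add: eig)
  finally show ?thesis .
qed

text \<open>For \<open>j = 0\<close> the eigenvector is the constant 1, whose eigenvalue is the row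
  sum.\<close>

lemma johnson_degree_eigenvalue:
  assumes "s < r" "2 * r < n"
  shows "(\<Sum>k\<le>r. \<alpha> k * kernel_eigenvalue n r k 0) = real (johnson_N1 n r s)"
proof -
  have x0: "{1..r} \<in> johnson_vertices n r" using assms(2) by (auto simp: johnson_vertices_def)
  show ?thesis
    using walks_eigenvector[OF assms(2) _ x0, of 0 1] walks_row_sum[OF _ x0, of s 1] assms(1)
    by (simp del: walks.simps)
qed

end

section \<open>Asymptotics of multiplicities and eigenvalues\<close>

text \<open>The rate is carried along because the bound C/n on each \<delta> needs it; closure under
  the field operations then spares any explicit error term.\<close>

definition asy :: "(nat \<Rightarrow> real) \<Rightarrow> real \<Rightarrow> bool" where
  "asy F c \<longleftrightarrow> (\<lambda>n. F n - c) \<in> O(\<lambda>n. 1 / real n)"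

lemma asy_const [simp]: "asy (\<lambda>_. c) c"
  by (simp add: asy_def)

lemma asy_inverse_nat: "asy (\<lambda>n. 1 / real n) 0"
  by (simp add: asy_def)

lemma asy_tendsto:
  assumes "asy F c"
  shows "F \<longlonglongrightarrow> c"
proof -
  have "(\<lambda>n. 1 / real n) \<in> o(\<lambda>_. 1)" by real_asymp
  with assms have "(\<lambda>n. F n - c) \<in> o(\<lambda>_. 1)"
    unfolding asy_def by (rule landau_o.big_small_trans)
  from smalloD_tendsto[OF this] have "((\<lambda>n. F n - c) \<longlongrightarrow> 0) at_top" by simp
  then show ?thesis by (simp add: LIM_zero_iff)
qed

lemma asy_bigo_1: "asy F c \<Longrightarrow> F \<in> O(\<lambda>_. 1)"
  by (rule bigoI_tendsto[where c = c]) (auto dest: asy_tendsto)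

lemma asy_cong:
  assumes "eventually (\<lambda>n. F n = G n) at_top"
  shows "asy F c \<longleftrightarrow> asy G c"
  unfolding asy_def by (rule landau_o.big.in_cong) (use assms in eventually_elim, simp)

lemma asy_add:
  assumes "asy F c" "asy G d"
  shows "asy (\<lambda>n. F n + G n) (c + d)"
  using sum_in_bigo(1)[OF assms[unfolded asy_def]] by (simp add: asy_def algebra_simps)

lemma asy_diff:
  assumes "asy F c" "asy G d"
  shows "asy (\<lambda>n. F n - G n) (c - d)"
  using sum_in_bigo(2)[OF assms[unfolded asy_def]] by (simp add: asy_def algebra_simps)

lemma asy_mult:
  assumes "asy F c" "asy G d"
  shows "asy (\<lambda>n. F n * G n) (c * d)"
proof -
  have "(\<lambda>n. F n * (G n - d)) \<in> O(\<lambda>n. 1 * (1 / real n))"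
    using asy_bigo_1[OF assms(1)] assms(2) unfolding asy_def by (rule landau_o.big.mult)
  moreover have "(\<lambda>n. d * (F n - c)) \<in> O(\<lambda>n. 1 / real n)"
    using assms(1) unfolding asy_def by simp
  ultimately have "(\<lambda>n. F n * (G n - d) + d * (F n - c)) \<in> O(\<lambda>n. 1 / real n)"
    by (intro sum_in_bigo) simp_all
  then show ?thesis by (simp add: asy_def algebra_simps)
qed

lemma asy_divide:
  assumes "asy F c" "asy G d" "d \<noteq> 0"
  shows "asy (\<lambda>n. F n / G n) (c / d)"
proof -
  have lim: "G \<longlonglongrightarrow> d" by (rule asy_tendsto[OF assms(2)])
  then have nz: "eventually (\<lambda>n. G n \<noteq> 0) at_top"
    using assms(3) tendsto_imp_eventually_ne by blast
  \<comment> \<open>This is the numerator of F/G - c/d over the denominator G d.\<close>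
  have "(\<lambda>n. d * (F n - c) - c * (G n - d)) \<in> O(\<lambda>n. 1 / real n)"
    using assms(1,2) unfolding asy_def by (intro sum_in_bigo) auto
  moreover have "(\<lambda>n. 1 / (G n * d)) \<in> O(\<lambda>_. 1)"
    by (rule bigoI_tendsto[where c = "1 / (d * d)"]) (use assms(3) lim in \<open>auto intro!: tendsto_intros\<close>)
  ultimately have "(\<lambda>n. (d * (F n - c) - c * (G n - d)) * (1 / (G n * d))) \<in> O(\<lambda>n. 1 / real n * 1)"
    by (rule landau_o.big.mult)
  moreover have "eventually (\<lambda>n. (d * (F n - c) - c * (G n - d)) * (1 / (G n * d)) = F n / G n - c / d) at_top"
    using nz by eventually_elim (use assms(3) in \<open>simp add: field_simps\<close>)
  ultimately show ?thesis unfolding asy_def by (simp add: landau_o.big.in_cong)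
qed

lemma asy_sum:
  assumes "\<And>i. i \<in> I \<Longrightarrow> asy (F i) (c i)"
  shows "asy (\<lambda>n. \<Sum>i\<in>I. F i n) (\<Sum>i\<in>I. c i)"
  using assms by (induction I rule: infinite_finite_induct) (auto intro: asy_add)

lemma asy_bound:
  assumes "asy F c"
  shows "\<exists>K>0. eventually (\<lambda>n. \<bar>F n - c\<bar> \<le> K / real n) at_top"
proof -
  obtain K where "K > 0" "eventually (\<lambda>n. norm (F n - c) \<le> K * norm (1 / real n)) at_top"
    using assms unfolding asy_def by (elim landau_o.bigE)
  then show ?thesis by auto
qed

lemma asy_power_quotient:
  assumes "i < j"
  shows "asy (\<lambda>n. real n ^ i / real n ^ j) 0"
proof -
  have "(\<lambda>n. real n ^ i / real n ^ j) \<in> O(\<lambda>n. 1 / real n)"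
  proof (rule bigoI[where c = 1], rule eventually_mono[OF eventually_gt_at_top[of 0]])
    fix n :: nat assume "0 < n"
    then have "real n ^ i * real n \<le> real n ^ j"
      using power_increasing[of "Suc i" j "real n"] assms by (simp add: mult.commute)
    then show "norm (real n ^ i / real n ^ j) \<le> 1 * norm (1 / real n)"
      using \<open>0 < n\<close> by (simp add: field_simps)
  qed
  then show ?thesis by (simp add: asy_def)
qed

lemma asy_power_quotient_same: "asy (\<lambda>n. real n ^ i / real n ^ i) 1"
  by (subst asy_cong[of _ "\<lambda>_. 1"]) (auto intro!: eventually_mono[OF eventually_gt_at_top[of 0]])

lemma asy_nat_diff: "asy (\<lambda>n. real (n - p) / real n) 1"
proof -
  have "asy (\<lambda>n. 1 - real p * (1 / real n)) (1 - real p * 0)"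
    by (intro asy_diff asy_mult asy_const asy_inverse_nat)
  moreover have "eventually (\<lambda>n. real (n - p) / real n = 1 - real p * (1 / real n)) at_top"
    by (rule eventually_mono[OF eventually_gt_at_top[of p]]) (auto simp: field_simps of_nat_diff)
  ultimately show ?thesis by (simp add: asy_cong)
qed

text \<open>Induction by absorption: each step splits off a factor (n - p)/n and raises the shift
  \<open>p\<close>, which is therefore left arbitrary.\<close>

lemma asy_binomial: "asy (\<lambda>n. real ((n - p) choose q) / real n ^ q) (1 / fact q)"
proof (induction q arbitrary: p)
  case (Suc q)
  have eq: "real ((n - p) choose Suc q) / real n ^ Suc q
    = (1 / real (Suc q)) * (real (n - p) / real n * (real ((n - Suc p) choose q) / real n ^ q))" for n
  proof -
    have "real (Suc q) * real ((n - p) choose Suc q) = real (n - p) * real ((n - Suc p) choose q)"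
      using binomial_absorption[of q "n - p"] by (metis diff_Suc_1' diff_Suc_eq_diff_pred diff_commute of_nat_mult One_nat_def)
    then have "real ((n - p) choose Suc q) = (1 / real (Suc q)) * (real (n - p) * real ((n - Suc p) choose q))"
      by (simp add: field_simps)
    then show ?thesis by simp
  qed
  have "asy (\<lambda>n. (1 / real (Suc q)) * (real (n - p) / real n * (real ((n - Suc p) choose q) / real n ^ q)))
    ((1 / real (Suc q)) * (1 * (1 / fact q)))"
    by (intro asy_mult asy_const asy_nat_diff Suc.IH)
  then show ?case by (simp only: eq) (simp add: mult.commute)
qed simp

section \<open>Orders of magnitude of multiplicities and eigenvalues\<close>

lemma asy_kernel_eigenvalue:
  "asy (\<lambda>n. kernel_eigenvalue n r k j / real n ^ (r - k))
    (if j \<le> k then real ((r - j) choose (k - j)) / fact (r - k) else 0)"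
  using asy_mult[OF asy_const[of "real ((r - j) choose (k - j))"] asy_binomial[of "k + j" "r - k"]]
  by (simp add: kernel_eigenvalue_def)

text \<open>Row \<open>k = j\<close> of the system is solved for \<open>m n j\<close>. Every earlier
  unknown enters with a factor n^(i-j) and drops out, which leaves (r choose j) (r-j)! / r! = 1 /
  j!.\<close>

lemma asy_multiplicity:
  assumes m: "\<And>n k. 2 * r < n \<Longrightarrow> k \<le> r \<Longrightarrow>
      real (n choose r) * real (r choose k) = (\<Sum>j\<le>r. kernel_eigenvalue n r k j * m n j)"
    and "j \<le> r"
  shows "asy (\<lambda>n. m n j / real n ^ j) (1 / fact j)"
  using assms(2)
proof (induction j rule: less_induct)
  case (less j)
  let ?N = "\<lambda>n. real n" and ?k = "\<lambda>n i. kernel_eigenvalue n r j i"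
  \<comment> \<open>Row \<open>j\<close> divided by n^r, with each factor paired with its own power
    of n so that it has a limit.\<close>
  let ?F = "\<lambda>n. (real (n choose r) / ?N n ^ r * real (r choose j)
      - (\<Sum>i<j. ?k n i / ?N n ^ (r - j) * (m n i / ?N n ^ i) * (?N n ^ i / ?N n ^ j)))
    / (?k n j / ?N n ^ (r - j))"
  have "asy ?F ((1 / fact r * real (r choose j)
      - (\<Sum>i<j. real ((r - i) choose (j - i)) / fact (r - j) * (1 / fact i) * 0))
    / (1 / fact (r - j)))"
  proof -
    have N: "asy (\<lambda>n. real (n choose r) / ?N n ^ r) (1 / fact r)"
      using asy_binomial[of 0 r] by simp
    have D: "asy (\<lambda>n. ?k n j / ?N n ^ (r - j)) (1 / fact (r - j))"
      using asy_kernel_eigenvalue[of r j j] by simp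
    have S: "asy (\<lambda>n. \<Sum>i<j. ?k n i / ?N n ^ (r - j) * (m n i / ?N n ^ i) * (?N n ^ i / ?N n ^ j))
      (\<Sum>i<j. real ((r - i) choose (j - i)) / fact (r - j) * (1 / fact i) * 0)"
    proof (rule asy_sum)
      fix i assume "i \<in> {..<j}"
      then have i: "i < j" "i \<le> r" using less.prems by auto
      then have "asy (\<lambda>n. ?k n i / ?N n ^ (r - j)) (real ((r - i) choose (j - i)) / fact (r - j))"
        using asy_kernel_eigenvalue[of r j i] by simp
      then show "asy (\<lambda>n. ?k n i / ?N n ^ (r - j) * (m n i / ?N n ^ i) * (?N n ^ i / ?N n ^ j))
          (real ((r - i) choose (j - i)) / fact (r - j) * (1 / fact i) * 0)"
        by (rule asy_mult[OF asy_mult[OF _ less.IH[OF i]] asy_power_quotient[OF i(1)]])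
    qed
    show ?thesis
      by (rule asy_divide[OF asy_diff[OF asy_mult[OF N asy_const] S] D]) simp
  qed
  also have "(1 / fact r * real (r choose j)
      - (\<Sum>i<j. real ((r - i) choose (j - i)) / fact (r - j) * (1 / fact i) * 0))
    / (1 / fact (r - j)) = (1 / fact j :: real)"
    using binomial_fact[OF less.prems, where 'a = real] by simp
  finally have "asy ?F (1 / fact j)" .
  moreover have "eventually (\<lambda>n. m n j / ?N n ^ j = ?F n) at_top"
  proof (rule eventually_mono[OF eventually_gt_at_top[of "2 * r"]])
    fix n assume n: "2 * r < n"
    then have pos: "?N n > 0" by simp
    have "?k n j > 0"
      using n less.prems by (auto simp: kernel_eigenvalue_def zero_less_binomial_iff)
    have "(\<Sum>i\<le>r. ?k n i * m n i) = (\<Sum>i\<le>j. ?k n i * m n i)"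
      by (rule sum.mono_neutral_right) (use less.prems in \<open>auto simp: kernel_eigenvalue_def\<close>)
    also have "\<dots> = (\<Sum>i<j. ?k n i * m n i) + ?k n j * m n j"
      by (simp flip: lessThan_Suc_atMost)
    finally have "m n j * ?k n j = real (n choose r) * real (r choose j) - (\<Sum>i<j. ?k n i * m n i)"
      using m[OF n less.prems] by simp
    moreover have "(\<Sum>i<j. ?k n i / ?N n ^ (r - j) * (m n i / ?N n ^ i) * (?N n ^ i / ?N n ^ j))
      = (\<Sum>i<j. ?k n i * m n i) / ?N n ^ r"
    proof -
      have "?N n ^ (r - j) * ?N n ^ j = ?N n ^ r" using less.prems by (simp flip: power_add)
      then show ?thesis
        unfolding sum_divide_distrib using pos by (intro sum.cong refl) (simp add: field_simps)
    qed
    ultimately have "?F n = m n j * ?k n j / ?N n ^ r / (?k n j / ?N n ^ (r - j))"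
      by (simp add: diff_divide_distrib)
    also have "\<dots> = m n j / ?N n ^ j"
    proof -
      have "?N n ^ r = ?N n ^ (r - j) * ?N n ^ j" using less.prems by (simp flip: power_add)
      then show ?thesis using pos \<open>?k n j > 0\<close> by (simp add: field_simps)
    qed
    finally show "m n j / ?N n ^ j = ?F n" by simp
  qed
  ultimately show ?case by (simp only: asy_cong)
qed

lemma asy_johnson_N1:
  "asy (\<lambda>n. real (johnson_N1 n r s) / real n ^ (r - s)) (real (r choose s) / fact (r - s))"
  using asy_mult[OF asy_const[of "real (r choose s)"] asy_binomial[of r "r - s"]]
  by (simp add: johnson_N1_def)

text \<open>Kernel \<open>k\<close> has eigenvalues of order at most n^(r-k). The coefficients
  vanish below \<open>s\<close>, so \<open>k = s\<close> dominates with order n^(r-s), the order of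
  the degree.\<close>

lemma asy_eigenvalue_ratio_low:
  assumes "s < r" "j \<le> s" "\<And>k. k < s \<Longrightarrow> \<alpha> k = 0" "\<alpha> s = 1"
  shows "asy (\<lambda>n. (\<Sum>k\<le>r. \<alpha> k * kernel_eigenvalue n r k j) / real (johnson_N1 n r s))
    (real ((r - j) choose (s - j)) / real (r choose s))"
proof -
  let ?N = "\<lambda>n. real n"
  let ?e = "real ((r - j) choose (s - j)) / fact (r - s)"
  have "asy (\<lambda>n. \<Sum>k\<le>r. \<alpha> k * (kernel_eigenvalue n r k j / ?N n ^ (r - k) * (?N n ^ (r - k) / ?N n ^ (r - s))))
    (\<Sum>k\<le>r. if k = s then ?e else 0)"
  proof (rule asy_sum)
    fix k assume "k \<in> {..r}"
    then consider "k < s" | "k = s" | "s < k" "k \<le> r" by fastforce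
    then show "asy (\<lambda>n. \<alpha> k * (kernel_eigenvalue n r k j / ?N n ^ (r - k) * (?N n ^ (r - k) / ?N n ^ (r - s))))
      (if k = s then ?e else 0)"
    proof cases
      case 2
      then show ?thesis
        using asy_mult[OF asy_kernel_eigenvalue[of r s j] asy_power_quotient_same[of "r - s"]] assms by simp
    next
      case 3
      then have lt: "r - k < r - s" by simp
      have "(if k = s then ?e else 0)
          = \<alpha> k * ((if j \<le> k then real ((r - j) choose (k - j)) / fact (r - k) else 0) * 0)"
        using 3 by simp
      then show ?thesis
        using asy_mult[OF asy_const[of "\<alpha> k"] asy_mult[OF asy_kernel_eigenvalue[of r k j] asy_power_quotient[OF lt]]]
        by (simp only:)
    qed (use assms in simp)
  qed
  from asy_divide[OF this asy_johnson_N1[of r s]]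
  have "asy (\<lambda>n. (\<Sum>k\<le>r. \<alpha> k * (kernel_eigenvalue n r k j / ?N n ^ (r - k) * (?N n ^ (r - k) / ?N n ^ (r - s))))
      / (real (johnson_N1 n r s) / ?N n ^ (r - s))) (?e / (real (r choose s) / fact (r - s)))"
    using assms(1) by (simp add: binomial_eq_0_iff)
  moreover have "eventually (\<lambda>n. (\<Sum>k\<le>r. \<alpha> k * kernel_eigenvalue n r k j) / real (johnson_N1 n r s)
    = (\<Sum>k\<le>r. \<alpha> k * (kernel_eigenvalue n r k j / ?N n ^ (r - k) * (?N n ^ (r - k) / ?N n ^ (r - s))))
      / (real (johnson_N1 n r s) / ?N n ^ (r - s))) at_top"
  proof (rule eventually_mono[OF eventually_gt_at_top[of 0]])
    fix n :: nat assume "0 < n"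
    then have "(\<Sum>k\<le>r. \<alpha> k * (kernel_eigenvalue n r k j / ?N n ^ (r - k) * (?N n ^ (r - k) / ?N n ^ (r - s))))
      = (\<Sum>k\<le>r. \<alpha> k * kernel_eigenvalue n r k j) / ?N n ^ (r - s)"
      unfolding sum_divide_distrib by (intro sum.cong) auto
    then show "(\<Sum>k\<le>r. \<alpha> k * kernel_eigenvalue n r k j) / real (johnson_N1 n r s)
      = (\<Sum>k\<le>r. \<alpha> k * (kernel_eigenvalue n r k j / ?N n ^ (r - k) * (?N n ^ (r - k) / ?N n ^ (r - s))))
        / (real (johnson_N1 n r s) / ?N n ^ (r - s))"
      using \<open>0 < n\<close> by simp
  qed
  ultimately show ?thesis using assms(1) by (simp only: asy_cong) simp
qed

text \<open>By triangularity only kernels with \<open>k \<ge> j\<close> contribute, so the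
  eigenvalue has order at most n^(r-j), against n^(r-s) for the degree. The limit is left unnamed:
  only boundedness matters.\<close>

lemma asy_eigenvalue_ratio_high:
  assumes "s < j" "j \<le> r"
  shows "\<exists>c. asy (\<lambda>n. (\<Sum>k\<le>r. \<alpha> k * kernel_eigenvalue n r k j) / real (johnson_N1 n r s) * real n ^ (j - s)) c"
proof -
  let ?N = "\<lambda>n. real n"
  have "\<exists>c. asy (\<lambda>n. \<alpha> k * (kernel_eigenvalue n r k j / ?N n ^ (r - j))) c" if "k \<le> r" for k
  proof (cases "j \<le> k")
    case True
    have "\<exists>c. asy (\<lambda>n. ?N n ^ (r - k) / ?N n ^ (r - j)) c"
    proof (cases "j = k")
      case True
      show ?thesis unfolding True by (rule exI, rule asy_power_quotient_same)
    next
      case False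
      then have "r - k < r - j" using \<open>j \<le> k\<close> that by simp
      then show ?thesis using asy_power_quotient by (intro exI)
    qed
    then obtain c where "asy (\<lambda>n. ?N n ^ (r - k) / ?N n ^ (r - j)) c" by blast
    from asy_mult[OF asy_const[of "\<alpha> k"] asy_mult[OF asy_kernel_eigenvalue[of r k j] this]]
    have "\<exists>c. asy (\<lambda>n. \<alpha> k * (kernel_eigenvalue n r k j / ?N n ^ (r - k) * (?N n ^ (r - k) / ?N n ^ (r - j)))) c"
      by blast
    moreover have "eventually (\<lambda>n. \<alpha> k * (kernel_eigenvalue n r k j / ?N n ^ (r - j)) =
        \<alpha> k * (kernel_eigenvalue n r k j / ?N n ^ (r - k) * (?N n ^ (r - k) / ?N n ^ (r - j)))) at_top"
      by (rule eventually_mono[OF eventually_gt_at_top[of 0]]) simp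
    ultimately show ?thesis by (simp only: asy_cong)
  next
    case False
    then have "asy (\<lambda>n. \<alpha> k * (kernel_eigenvalue n r k j / ?N n ^ (r - j))) 0"
      by (simp add: kernel_eigenvalue_def)
    then show ?thesis by blast
  qed
  then obtain c where "\<And>k. k \<in> {..r} \<Longrightarrow> asy (\<lambda>n. \<alpha> k * (kernel_eigenvalue n r k j / ?N n ^ (r - j))) (c k)"
    by (metis atMost_iff)
  then have S: "asy (\<lambda>n. \<Sum>k\<le>r. \<alpha> k * (kernel_eigenvalue n r k j / ?N n ^ (r - j))) (\<Sum>k\<le>r. c k)"
    by (rule asy_sum)
  have "\<exists>c. asy (\<lambda>n. (\<Sum>k\<le>r. \<alpha> k * (kernel_eigenvalue n r k j / ?N n ^ (r - j)))
      / (real (johnson_N1 n r s) / ?N n ^ (r - s))) c"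
    by (rule exI, rule asy_divide[OF S asy_johnson_N1]) (use assms in \<open>simp add: binomial_eq_0_iff\<close>)
  moreover have "eventually (\<lambda>n. (\<Sum>k\<le>r. \<alpha> k * kernel_eigenvalue n r k j) / real (johnson_N1 n r s) * ?N n ^ (j - s)
    = (\<Sum>k\<le>r. \<alpha> k * (kernel_eigenvalue n r k j / ?N n ^ (r - j)))
      / (real (johnson_N1 n r s) / ?N n ^ (r - s))) at_top"
  proof (rule eventually_mono[OF eventually_gt_at_top[of 0]])
    fix n :: nat assume "0 < n"
    have "?N n ^ (r - s) = ?N n ^ (r - j) * ?N n ^ (j - s)"
      using assms by (simp flip: power_add)
    then show "(\<Sum>k\<le>r. \<alpha> k * kernel_eigenvalue n r k j) / real (johnson_N1 n r s) * ?N n ^ (j - s)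
      = (\<Sum>k\<le>r. \<alpha> k * (kernel_eigenvalue n r k j / ?N n ^ (r - j)))
        / (real (johnson_N1 n r s) / ?N n ^ (r - s))"
      using \<open>0 < n\<close> by (simp flip: sum_divide_distrib)
  qed
  ultimately show ?thesis by (simp only: asy_cong)
qed

lemma hom_cycle_spectral_asymptotics:
  fixes r s :: nat
  assumes "s < r"
  obtains m \<rho> :: "nat \<Rightarrow> nat \<Rightarrow> real" where
    "\<And>n. 2 * r < n \<Longrightarrow> m n 0 = 1"
    "\<And>n. 2 * r < n \<Longrightarrow> \<rho> n 0 = 1"
    "\<And>n t. 2 * r < n \<Longrightarrow> 1 \<le> t \<Longrightarrow>
      real (hom_cycle_johnson t n r s) = real (johnson_N1 n r s) ^ t * (\<Sum>j\<le>r. m n j * \<rho> n j ^ t)"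
    "\<And>j. j \<le> r \<Longrightarrow> asy (\<lambda>n. m n j / real n ^ j) (1 / fact j)"
    "\<And>j. j \<le> s \<Longrightarrow> asy (\<lambda>n. \<rho> n j) (real ((r - j) choose (s - j)) / real (r choose s))"
    "\<And>j. s < j \<Longrightarrow> j \<le> r \<Longrightarrow> \<exists>c. asy (\<lambda>n. \<rho> n j * real n ^ (j - s)) c"
proof -
  obtain \<alpha> :: "nat \<Rightarrow> real" where \<alpha>: "\<And>k. k < s \<Longrightarrow> \<alpha> k = 0" "\<alpha> s = 1"
    and ind: "\<And>m. m \<le> r \<Longrightarrow> of_bool (m = s) = (\<Sum>k\<le>r. \<alpha> k * real (m choose k))"
    using indicator_binomial_basis[of s r] assms by auto
  have "\<exists>m. \<forall>k\<le>r. real (n choose r) * real (r choose k) = (\<Sum>j\<le>r. kernel_eigenvalue n r k j * m j)"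
    if "2 * r < n" for n
    by (rule triangular_system)
       (use that in \<open>auto simp: kernel_eigenvalue_def binomial_eq_0_iff\<close>)
  then obtain m where m: "\<And>n k. 2 * r < n \<Longrightarrow> k \<le> r \<Longrightarrow>
      real (n choose r) * real (r choose k) = (\<Sum>j\<le>r. kernel_eigenvalue n r k j * m n j)"
    by metis
  define ev where "ev = (\<lambda>n j. \<Sum>k\<le>r. \<alpha> k * kernel_eigenvalue n r k j)"
  define \<rho> where "\<rho> = (\<lambda>n j. ev n j / real (johnson_N1 n r s))"
  have N1: "real (johnson_N1 n r s) > 0" if "2 * r < n" for n
    using that assms by (simp add: johnson_N1_def zero_less_binomial_iff)
  show thesis
  proof (rule that)
    fix n assume n: "2 * r < n"
    have "(\<Sum>j\<le>r. kernel_eigenvalue n r 0 j * m n j) = (\<Sum>j\<le>r. if j = 0 then real (n choose r) * m n 0 else 0)"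
      by (rule sum.cong) (auto simp: kernel_eigenvalue_def)
    also have "\<dots> = real (n choose r) * m n 0" by simp
    finally show "m n 0 = 1" using m[OF n, of 0] n by (simp add: binomial_eq_0_iff)
    show "\<rho> n 0 = 1"
      using johnson_degree_eigenvalue[OF ind assms n] N1[OF n] by (simp add: \<rho>_def ev_def)
    fix t :: nat assume "1 \<le> t"
    then have "real (hom_cycle_johnson t n r s) = (\<Sum>j\<le>r. m n j * ev n j ^ t)"
      using hom_cycle_spectral[OF ind assms n _ m[OF n]] by (simp add: ev_def)
    also have "\<dots> = real (johnson_N1 n r s) ^ t * (\<Sum>j\<le>r. m n j * \<rho> n j ^ t)"
      unfolding sum_distrib_left using N1[OF n]
      by (intro sum.cong refl) (simp add: \<rho>_def power_divide)
    finally show "real (hom_cycle_johnson t n r s) = real (johnson_N1 n r s) ^ t * (\<Sum>j\<le>r. m n j * \<rho> n j ^ t)" .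
  next
    show "asy (\<lambda>n. m n j / real n ^ j) (1 / fact j)" if "j \<le> r" for j
      using asy_multiplicity[OF m that] by blast
    show "asy (\<lambda>n. \<rho> n j) (real ((r - j) choose (s - j)) / real (r choose s))" if "j \<le> s" for j
      using asy_eigenvalue_ratio_low[where \<alpha> = \<alpha>, OF assms that \<alpha>] by (simp add: \<rho>_def ev_def)
    show "\<exists>c. asy (\<lambda>n. \<rho> n j * real n ^ (j - s)) c" if "s < j" "j \<le> r" for j
      using asy_eigenvalue_ratio_high[OF that] by (simp add: \<rho>_def ev_def)
  qed
qed

section \<open>The expansion\<close>

text \<open>The t-th root of \<open>X\<close> stays between 1 - c and 1 + c, because (1 - c)^t <= 1
  - c and 1 + c <= (1 + c)^t. The bound is thus uniform in \<open>t\<close>;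
  \<open>c \<le> 1\<close> keeps the lower base nonnegative.\<close>

lemma absorb_factor_into_base:
  fixes c \<rho> X :: real
  assumes "0 < t" "c \<le> 1" "0 \<le> \<rho>" "\<bar>X - 1\<bar> \<le> c"
  shows "\<exists>\<beta>. \<beta> ^ t = X * \<rho> ^ t \<and> \<bar>\<beta> - \<rho>\<bar> \<le> c * \<rho>"
proof -
  have X: "1 - c \<le> X" "X \<le> 1 + c" and "0 \<le> c" "0 \<le> X" using assms by auto
  have "(1 - c) ^ t \<le> X"
    using power_decreasing[of 1 t "1 - c"] X assms \<open>0 \<le> c\<close> by simp
  then have "root t ((1 - c) ^ t) \<le> root t X" using assms(1) by simp
  then have lo: "1 - c \<le> root t X"
    using assms(1,2) by (simp add: real_root_power_cancel)
  have "X \<le> (1 + c) ^ t"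
    using self_le_power[of "1 + c" t] X assms(1) \<open>0 \<le> c\<close> by simp
  then have "root t X \<le> root t ((1 + c) ^ t)" using assms(1) by simp
  then have hi: "root t X \<le> 1 + c"
    using assms(1) \<open>0 \<le> c\<close> by (simp add: real_root_power_cancel)
  have "(root t X * \<rho>) ^ t = X * \<rho> ^ t"
    using assms(1) \<open>0 \<le> X\<close> by (simp add: power_mult_distrib)
  moreover have "\<bar>root t X * \<rho> - \<rho>\<bar> = \<bar>root t X - 1\<bar> * \<rho>"
  proof -
    have "root t X * \<rho> - \<rho> = (root t X - 1) * \<rho>" by (simp add: left_diff_distrib)
    then show ?thesis using assms(3) by (simp add: abs_mult)
  qed
  moreover have "\<bar>root t X - 1\<bar> * \<rho> \<le> c * \<rho>"
    using lo hi assms(3) by (intro mult_right_mono) auto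
  ultimately show ?thesis by metis
qed

lemma high_eigenvalue_negligible:
  fixes s j :: nat
  assumes "s < j" "asy (\<lambda>n. M n / real n ^ j) a" "asy (\<lambda>n. P n * real n ^ (j - s)) c" "asy \<rho> b" "0 < b"
  shows "\<exists>K. eventually (\<lambda>n. \<forall>t\<ge>2. \<bar>M n * P n ^ t\<bar> \<le> K / real n * (real n ^ s * \<rho> n ^ t)) at_top"
proof -
  \<comment> \<open>\<open>Q\<close> is chosen so that \<bar>P n\<bar> <= (Q / n^(j-s)) \<rho> n as
    soon as \<rho> n exceeds b / 2.\<close>
  define A B Q where "A = \<bar>a\<bar> + 1" and "B = \<bar>c\<bar> + 1" and "Q = 2 * B / b"
  have pos: "0 < A" "0 < B" "0 < Q" using assms(5) by (auto simp: A_def B_def Q_def)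
  have "eventually (\<lambda>n. \<bar>M n / real n ^ j\<bar> < A) at_top"
    by (rule order_tendstoD[OF tendsto_rabs[OF asy_tendsto[OF assms(2)]]]) (simp add: A_def)
  moreover have "eventually (\<lambda>n. \<bar>P n * real n ^ (j - s)\<bar> < B) at_top"
    by (rule order_tendstoD[OF tendsto_rabs[OF asy_tendsto[OF assms(3)]]]) (simp add: B_def)
  moreover have "eventually (\<lambda>n. b / 2 < \<rho> n) at_top"
    by (rule order_tendstoD[OF asy_tendsto[OF assms(4)]]) (use assms(5) in simp)
  moreover have "eventually (\<lambda>n. max 1 Q \<le> real n) at_top" by real_asymp
  ultimately have "eventually (\<lambda>n. \<forall>t\<ge>2. \<bar>M n * P n ^ t\<bar> \<le> A * Q\<^sup>2 / real n * (real n ^ s * \<rho> n ^ t)) at_top"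
  proof eventually_elim
    case (elim n)
    define N d x where "N = real n" and "d = j - s" and "x = Q / N ^ d"
    have N: "1 \<le> N" "Q \<le> N" using elim by (auto simp: N_def)
    have "N \<le> N ^ d" using N assms(1) by (intro self_le_power) (auto simp: d_def)
    then have x: "0 \<le> x" "x \<le> 1" using N pos by (auto simp: x_def)
    have \<rho>: "b / 2 < \<rho> n" "0 < \<rho> n" using elim assms(5) by auto
    have M: "\<bar>M n\<bar> \<le> A * N ^ j"
      using elim N by (simp add: N_def field_simps)
    have "\<bar>P n\<bar> \<le> B / N ^ d"
      using elim N by (simp add: N_def d_def field_simps abs_mult)
    also have "\<dots> = x * (b / 2)" using assms(5) by (simp add: x_def Q_def)
    also have "\<dots> \<le> x * \<rho> n" using \<rho> x by (intro mult_left_mono) auto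
    finally have P: "\<bar>P n\<bar> \<le> x * \<rho> n" .
    show ?case
    proof (intro allI impI)
      fix t :: nat assume "2 \<le> t"
      have "\<bar>M n * P n ^ t\<bar> \<le> (A * N ^ j) * (x * \<rho> n) ^ t"
        unfolding abs_mult power_abs using M P pos N by (intro mult_mono power_mono) auto
      also have "\<dots> = (A * N ^ j) * (x ^ t * \<rho> n ^ t)" by (simp add: power_mult_distrib)
      \<comment> \<open>This is where \<open>t \<ge> 2\<close> enters: two factors of
        \<open>x\<close> gain n^(2(j-s)), of which one half turns n^j into n^s and the other half is
        the smallness. All further factors are at most 1 because \<open>Q \<le> N\<close>.\<close>
      also have "\<dots> \<le> (A * N ^ j) * (x\<^sup>2 * \<rho> n ^ t)"
        using power_decreasing[OF \<open>2 \<le> t\<close> x] pos N \<rho> by (intro mult_left_mono mult_right_mono) auto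
      also have "\<dots> = A * Q\<^sup>2 / N ^ d * (N ^ s * \<rho> n ^ t)"
      proof -
        have "N ^ j = N ^ s * N ^ d" using assms(1) by (simp add: d_def flip: power_add)
        then show ?thesis using N by (simp add: x_def power2_eq_square)
      qed
      also have "\<dots> \<le> A * Q\<^sup>2 / N * (N ^ s * \<rho> n ^ t)"
        using \<open>N \<le> N ^ d\<close> N pos \<rho> by (intro mult_right_mono divide_left_mono) auto
      finally show "\<bar>M n * P n ^ t\<bar> \<le> A * Q\<^sup>2 / real n * (real n ^ s * \<rho> n ^ t)"
        by (simp add: N_def)
    qed
  qed
  then show ?thesis by blast
qed

lemma eventually_sum_bound:
  fixes F :: "'a \<Rightarrow> nat \<Rightarrow> nat \<Rightarrow> real"
  assumes "finite J" "\<And>j. j \<in> J \<Longrightarrow> \<exists>K. eventually (\<lambda>n. \<forall>t\<ge>2. \<bar>F j n t\<bar> \<le> K / real n * G n t) at_top"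
  shows "\<exists>K. eventually (\<lambda>n. \<forall>t\<ge>2. \<bar>\<Sum>j\<in>J. F j n t\<bar> \<le> K / real n * G n t) at_top"
  using assms
proof (induction J rule: finite_induct)
  case empty
  then show ?case by (intro exI[of _ 0]) simp
next
  case (insert i J)
  obtain K where "eventually (\<lambda>n. \<forall>t\<ge>2. \<bar>\<Sum>j\<in>J. F j n t\<bar> \<le> K / real n * G n t) at_top"
    using insert by auto
  moreover obtain L where "eventually (\<lambda>n. \<forall>t\<ge>2. \<bar>F i n t\<bar> \<le> L / real n * G n t) at_top"
    using insert by auto
  ultimately have "eventually (\<lambda>n. \<forall>t\<ge>2. \<bar>\<Sum>j\<in>insert i J. F j n t\<bar> \<le> (L + K) / real n * G n t) at_top"
  proof eventually_elim
    case (elim n)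
    show ?case
    proof (intro allI impI)
      fix t :: nat assume t: "2 \<le> t"
      have "\<bar>\<Sum>j\<in>insert i J. F j n t\<bar> \<le> \<bar>F i n t\<bar> + \<bar>\<Sum>j\<in>J. F j n t\<bar>"
        using insert by (simp add: abs_triangle_ineq)
      also have "\<dots> \<le> L / real n * G n t + K / real n * G n t"
        using elim t by (intro add_mono) auto
      finally show "\<bar>\<Sum>j\<in>insert i J. F j n t\<bar> \<le> (L + K) / real n * G n t"
        by (simp add: add_divide_distrib distrib_right)
    qed
  qed
  then show ?case by blast
qed

lemma asy_uniform_bound:
  assumes "finite J" "\<And>j. j \<in> J \<Longrightarrow> asy (F j) (c j)"
  obtains K where "0 \<le> K" "eventually (\<lambda>n. \<forall>j\<in>J. \<bar>F j n - c j\<bar> \<le> K / real n) at_top"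
proof -
  have "\<forall>j\<in>J. \<exists>K>0. eventually (\<lambda>n. \<bar>F j n - c j\<bar> \<le> K / real n) at_top"
    using asy_bound assms(2) by blast
  then obtain K where K: "\<And>j. j \<in> J \<Longrightarrow> 0 < K j"
    "\<And>j. j \<in> J \<Longrightarrow> eventually (\<lambda>n. \<bar>F j n - c j\<bar> \<le> K j / real n) at_top"
    by metis
  have le: "K j \<le> (\<Sum>j\<in>J. K j)" if "j \<in> J" for j
    using that K(1) assms(1) by (intro member_le_sum) (auto intro: less_imp_le)
  have "eventually (\<lambda>n. \<forall>j\<in>J. \<bar>F j n - c j\<bar> \<le> (\<Sum>j\<in>J. K j) / real n) at_top"
  proof (intro eventually_ball_finite[OF assms(1)] ballI)
    fix j assume j: "j \<in> J"
    from K(2)[OF j] show "eventually (\<lambda>n. \<bar>F j n - c j\<bar> \<le> (\<Sum>j\<in>J. K j) / real n) at_top"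
      by eventually_elim (use le[OF j] in \<open>auto elim!: order_trans intro: divide_right_mono\<close>)
  qed
  moreover have "0 \<le> (\<Sum>j\<in>J. K j)" using K(1) by (intro sum_nonneg) (auto intro: less_imp_le)
  ultimately show thesis by (rule that[rotated])
qed

definition limit_ratio :: "nat \<Rightarrow> nat \<Rightarrow> nat \<Rightarrow> real" where
  "limit_ratio r s j = real ((r - j) choose (s - j)) / real (r choose s)"

lemma limit_ratio_pos: "s < r \<Longrightarrow> 0 < limit_ratio r s j"
  by (simp add: limit_ratio_def zero_less_binomial_iff)

lemma limit_ratio_0: "s < r \<Longrightarrow> limit_ratio r s 0 = 1"
  by (simp add: limit_ratio_def)

definition hom_expansion :: "nat \<Rightarrow> nat \<Rightarrow> nat \<Rightarrow> nat \<Rightarrow> (nat \<Rightarrow> real) \<Rightarrow> real" where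
  "hom_expansion r s n t \<delta> = real (johnson_N1 n r s) ^ t *
    (1 + \<delta> 0 + (\<Sum>j=1..s. real n ^ j / fact j * (limit_ratio r s j + \<delta> j) ^ t))"

text \<open>Each multiplicity is n^j / j! times a factor close to 1, whose root moves into the base.
  The triangle inequality through the true eigenvalue ratio then bounds \<delta>.\<close>

lemma hom_cycle_expansion_large:
  assumes "s < r"
  shows "\<exists>C n0. \<forall>n\<ge>n0. \<forall>t\<ge>2. \<exists>\<delta>. (\<forall>j\<le>s. \<bar>\<delta> j\<bar> \<le> C / real n) \<and>
    real (hom_cycle_johnson t n r s) = hom_expansion r s n t \<delta>"
proof -
  obtain m \<rho> :: "nat \<Rightarrow> nat \<Rightarrow> real" where
    m0: "\<And>n. 2 * r < n \<Longrightarrow> m n 0 = 1" and \<rho>0: "\<And>n. 2 * r < n \<Longrightarrow> \<rho> n 0 = 1" and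
    hom: "\<And>n t. 2 * r < n \<Longrightarrow> 1 \<le> t \<Longrightarrow>
      real (hom_cycle_johnson t n r s) = real (johnson_N1 n r s) ^ t * (\<Sum>j\<le>r. m n j * \<rho> n j ^ t)" and
    m: "\<And>j. j \<le> r \<Longrightarrow> asy (\<lambda>n. m n j / real n ^ j) (1 / fact j)" and
    low: "\<And>j. j \<le> s \<Longrightarrow> asy (\<lambda>n. \<rho> n j) (limit_ratio r s j)" and
    high: "\<And>j. s < j \<Longrightarrow> j \<le> r \<Longrightarrow> \<exists>c. asy (\<lambda>n. \<rho> n j * real n ^ (j - s)) c"
    using hom_cycle_spectral_asymptotics[OF assms] unfolding limit_ratio_def by blast
  define b where "b = limit_ratio r s"
  define R where "R = (\<lambda>n t. \<Sum>j\<in>{s<..r}. m n j * \<rho> n j ^ t)"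
  obtain K1 where K1: "0 \<le> K1" "eventually (\<lambda>n. \<forall>j\<in>{..s}. \<bar>m n j / real n ^ j * fact j - 1\<bar> \<le> K1 / real n) at_top"
  proof (rule asy_uniform_bound[of "{..s}" "\<lambda>j n. m n j / real n ^ j * fact j" "\<lambda>_. 1"])
    fix j assume "j \<in> {..s}"
    then show "asy (\<lambda>n. m n j / real n ^ j * fact j) 1"
      using asy_mult[OF m[of j] asy_const[of "fact j"]] assms by simp
  qed auto
  obtain K2 where K2: "0 \<le> K2" "eventually (\<lambda>n. \<forall>j\<in>{..s}. \<bar>\<rho> n j - b j\<bar> \<le> K2 / real n) at_top"
    by (rule asy_uniform_bound[of "{..s}" "\<lambda>j n. \<rho> n j" b]) (auto simp: b_def intro: low)
  have "\<exists>K. eventually (\<lambda>n. \<forall>t\<ge>2. \<bar>R n t\<bar> \<le> K / real n * (real n ^ s * \<rho> n s ^ t)) at_top"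
    unfolding R_def
  proof (rule eventually_sum_bound)
    fix j assume "j \<in> {s<..r}"
    then have j: "s < j" "j \<le> r" by auto
    then obtain c where "asy (\<lambda>n. \<rho> n j * real n ^ (j - s)) c" using high by blast
    from high_eigenvalue_negligible[OF j(1) m[OF j(2)] this low[OF order_refl] limit_ratio_pos[OF assms]]
    show "\<exists>K. eventually (\<lambda>n. \<forall>t\<ge>2. \<bar>m n j * \<rho> n j ^ t\<bar> \<le> K / real n * (real n ^ s * \<rho> n s ^ t)) at_top" .
  qed simp
  then obtain K3 where K3: "eventually (\<lambda>n. \<forall>t\<ge>2. \<bar>R n t\<bar> \<le> K3 / real n * (real n ^ s * \<rho> n s ^ t)) at_top" ..
  have pos: "eventually (\<lambda>n. \<forall>j\<in>{..s}. 0 < \<rho> n j) at_top"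
    by (intro eventually_ball_finite ballI finite_atMost order_tendstoD(1)[OF asy_tendsto[OF low]])
       (use assms in \<open>auto simp: limit_ratio_pos\<close>)
  define L where "L = K1 + fact s * \<bar>K3\<bar>"
  have "0 \<le> L" using K1 by (simp add: L_def)
  have "eventually (\<lambda>n. L / real n \<le> 1) at_top" by real_asymp
  from this K1(2) K2(2) K3 pos eventually_gt_at_top[of "2 * r"]
  \<comment> \<open>In the constant, \<open>(\<Sum>j\<le>s. b j) + K2\<close> bounds every \<rho>,
    so the product with \<open>L\<close> pays for the root, \<open>K2\<close> for the distance of
    \<rho> from its limit, and the last \<open>L\<close> for index 0.\<close>
  have "eventually (\<lambda>n. \<forall>t\<ge>2. \<exists>\<delta>. (\<forall>j\<le>s. \<bar>\<delta> j\<bar> \<le> (L * ((\<Sum>j\<le>s. b j) + K2) + K2 + L) / real n) \<and>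
    real (hom_cycle_johnson t n r s) = hom_expansion r s n t \<delta>) at_top"
  proof eventually_elim
    case (elim n)
    define N where "N = real n"
    have N: "1 \<le> N" using elim by (simp add: N_def)
    show ?case
    proof (intro allI impI)
      fix t :: nat assume t: "2 \<le> t"
      \<comment> \<open>The relative error of the multiplicity; at \<open>j = s\<close> the whole
        remainder \<open>R\<close> is added, measured in units of n^s / s! times the t-th power of
        \<rho>.\<close>
      define X where "X = (\<lambda>j. m n j / N ^ j * fact j + (if j = s then R n t * fact s / (N ^ s * \<rho> n s ^ t) else 0))"
      have X: "\<bar>X j - 1\<bar> \<le> L / N" if "j \<le> s" for j
      proof -
        have "\<bar>R n t * fact s / (N ^ s * \<rho> n s ^ t)\<bar> \<le> fact s * \<bar>K3\<bar> / N"
        proof -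
          have p: "0 < N ^ s * \<rho> n s ^ t" using elim N by simp
          have "\<bar>R n t\<bar> \<le> K3 / N * (N ^ s * \<rho> n s ^ t)" using elim t by (simp add: N_def)
          also have "\<dots> \<le> \<bar>K3\<bar> / N * (N ^ s * \<rho> n s ^ t)"
            using p N by (intro mult_right_mono divide_right_mono) auto
          finally have "\<bar>R n t\<bar> / (N ^ s * \<rho> n s ^ t) \<le> \<bar>K3\<bar> / N"
            using p by (simp only: pos_divide_le_eq)
          then have "fact s * (\<bar>R n t\<bar> / (N ^ s * \<rho> n s ^ t)) \<le> fact s * (\<bar>K3\<bar> / N)"
            by (intro mult_left_mono) auto
          moreover have "\<bar>R n t * fact s / (N ^ s * \<rho> n s ^ t)\<bar> = fact s * (\<bar>R n t\<bar> / (N ^ s * \<rho> n s ^ t))"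
            unfolding abs_divide abs_of_pos[OF p] by (simp add: abs_mult)
          ultimately show ?thesis by simp
        qed
        moreover have "\<bar>m n j / N ^ j * fact j - 1\<bar> \<le> K1 / N"
          using elim that by (simp add: N_def)
        moreover have "0 \<le> fact s * \<bar>K3\<bar> / N" using N by simp
        moreover have "\<bar>X j - 1\<bar> \<le> \<bar>m n j / N ^ j * fact j - 1\<bar>
            + (if j = s then \<bar>R n t * fact s / (N ^ s * \<rho> n s ^ t)\<bar> else 0)"
        proof -
          have "\<bar>x + (if j = s then y else 0) - 1\<bar> \<le> \<bar>x - 1\<bar> + (if j = s then \<bar>y\<bar> else 0)" for x y :: real
            using abs_triangle_ineq[of "x - 1" y] by (simp add: algebra_simps)
          then show ?thesis unfolding X_def .
        qed
        moreover have "L / N = K1 / N + fact s * \<bar>K3\<bar> / N"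
          by (simp only: L_def add_divide_distrib)
        ultimately show ?thesis by argo
      qed
      have "\<exists>\<beta>. \<beta> ^ t = X j * \<rho> n j ^ t \<and> \<bar>\<beta> - \<rho> n j\<bar> \<le> L / N * \<rho> n j" if "j \<le> s" for j
        using t elim that X[OF that] by (intro absorb_factor_into_base) (auto simp: N_def less_imp_le)
      then obtain \<beta> where \<beta>: "\<And>j. j \<le> s \<Longrightarrow> \<beta> j ^ t = X j * \<rho> n j ^ t"
        "\<And>j. j \<le> s \<Longrightarrow> \<bar>\<beta> j - \<rho> n j\<bar> \<le> L / N * \<rho> n j" by metis
      \<comment> \<open>Index 0 carries no power in the expansion and has ratio exactly 1, so the
        error of \<open>X 0\<close> is used without a root. This also covers \<open>s = 0\<close>,
        where \<open>X 0\<close> contains the remainder.\<close>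
      define \<delta> where "\<delta> = (\<lambda>j. if j = 0 then X 0 - 1 else \<beta> j - b j)"
      have bs: "b j \<le> (\<Sum>j\<le>s. b j)" "0 \<le> (\<Sum>j\<le>s. b j)" if "j \<le> s" for j
        using that limit_ratio_pos[OF assms] by (auto simp: b_def less_imp_le intro!: member_le_sum sum_nonneg)
      have "\<bar>\<delta> j\<bar> \<le> (L * ((\<Sum>j\<le>s. b j) + K2) + K2 + L) / N" if j: "j \<le> s" for j
      proof (cases "j = 0")
        case True
        have "0 \<le> L * ((\<Sum>j\<le>s. b j) + K2) + K2" using \<open>0 \<le> L\<close> K2 bs[OF j] by simp
        then have "L / N \<le> (L * ((\<Sum>j\<le>s. b j) + K2) + K2 + L) / N"
          using N by (intro divide_right_mono) auto
        then show ?thesis using X[of 0] True by (simp add: \<delta>_def)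
      next
        case False
        have \<rho>: "\<bar>\<rho> n j - b j\<bar> \<le> K2 / N" using elim j by (simp add: N_def)
        moreover have "K2 / N \<le> K2" using N K2 by (simp add: divide_le_eq mult_le_cancel_left1)
        ultimately have "\<rho> n j \<le> (\<Sum>j\<le>s. b j) + K2" using bs[OF j] by linarith
        then have "L / N * \<rho> n j \<le> L / N * ((\<Sum>j\<le>s. b j) + K2)"
          using \<open>0 \<le> L\<close> N by (intro mult_left_mono) auto
        moreover have "\<bar>\<beta> j - b j\<bar> \<le> \<bar>\<beta> j - \<rho> n j\<bar> + \<bar>\<rho> n j - b j\<bar>" by linarith
        moreover have "0 \<le> L / N" using \<open>0 \<le> L\<close> N by simp
        ultimately have "\<bar>\<beta> j - b j\<bar> \<le> L / N * ((\<Sum>j\<le>s. b j) + K2) + K2 / N + L / N"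
          using \<beta>(2)[OF j] \<rho> by linarith
        then show ?thesis using False by (simp add: \<delta>_def add_divide_distrib)
      qed
      moreover have "real (hom_cycle_johnson t n r s) = hom_expansion r s n t \<delta>"
      proof -
        have "(\<Sum>j\<le>r. m n j * \<rho> n j ^ t) = (\<Sum>j\<le>s. m n j * \<rho> n j ^ t) + R n t"
          unfolding R_def using assms
          by (subst sum.union_disjoint[symmetric]) (auto intro!: sum.cong)
        also have "\<dots> = (\<Sum>j\<le>s. m n j * \<rho> n j ^ t + (if j = s then R n t else 0))"
          by (simp add: sum.distrib)
        also have "\<dots> = (\<Sum>j\<le>s. N ^ j / fact j * (X j * \<rho> n j ^ t))"
        proof (rule sum.cong[OF refl])
          fix j assume "j \<in> {..s}"
          then have "0 < \<rho> n j" using elim by simp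
          then show "m n j * \<rho> n j ^ t + (if j = s then R n t else 0) = N ^ j / fact j * (X j * \<rho> n j ^ t)"
            using N by (auto simp: X_def field_simps)
        qed
        also have "\<dots> = X 0 + (\<Sum>j=1..s. N ^ j / fact j * (X j * \<rho> n j ^ t))"
          using \<rho>0 elim by (simp add: sum.atMost_shift sum.atLeast1_atMost_eq atMost_atLeast0 sum.atLeast_Suc_atMost)
        also have "\<dots> = 1 + \<delta> 0 + (\<Sum>j=1..s. N ^ j / fact j * (b j + \<delta> j) ^ t)"
          using \<beta>(1) by (simp add: \<delta>_def)
        finally show ?thesis
          using hom[of n t] elim t by (simp add: hom_expansion_def b_def N_def)
      qed
      ultimately show "\<exists>\<delta>. (\<forall>j\<le>s. \<bar>\<delta> j\<bar> \<le> (L * ((\<Sum>j\<le>s. b j) + K2) + K2 + L) / real n) \<and>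
          real (hom_cycle_johnson t n r s) = hom_expansion r s n t \<delta>"
        unfolding N_def by blast
    qed
  qed
  then show ?thesis unfolding eventually_at_top_linorder by blast
qed

text \<open>For the finitely many small \<open>n\<close>, each \<open>\<delta> j\<close> with \<open>j > 0\<close> cancels its base and \<open>\<delta> 0\<close> carries
  everything. At \<open>n = 0\<close> the bound \<open>C / n\<close> is \<open>0\<close>, but there both sides vanish.\<close>

lemma hom_cycle_expansion_small:
  assumes "s < r" "2 \<le> t"
  shows "\<exists>\<delta>. (\<forall>j\<le>s. \<bar>\<delta> j\<bar> \<le> (2 ^ n + 1 + (\<Sum>j\<le>s. limit_ratio r s j)) * (if n = 0 then 0 else 1)) \<and>
    real (hom_cycle_johnson t n r s) = hom_expansion r s n t \<delta>"
proof (cases "n = 0")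
  case True
  then have "johnson_N1 n r s = 0"
    using assms by (simp add: johnson_N1_def binomial_eq_0_iff)
  then have "hom_cycle_johnson t n r s = 0" "johnson_N1 n r s = 0"
    using hom_cycle_le[OF assms(1), of t n] assms(2) by (auto simp: power_0_left)
  then show ?thesis using assms by (intro exI[of _ "\<lambda>_. 0"]) (simp add: hom_expansion_def True)
next
  case False
  define h where "h = real (hom_cycle_johnson t n r s) / real (johnson_N1 n r s) ^ t"
  have le: "real (hom_cycle_johnson t n r s) \<le> real (n choose r) * real (johnson_N1 n r s) ^ t"
    using hom_cycle_le[OF assms(1)] assms(2) by simp
  \<comment> \<open>If the degree is 0, then \<open>h\<close> is a division by zero, but
    \<open>le\<close> forces the count to be 0 as well.\<close>
  have eq: "real (hom_cycle_johnson t n r s) = real (johnson_N1 n r s) ^ t * h"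
    using le assms(2) by (cases "johnson_N1 n r s = 0") (auto simp: h_def power_0_left)
  have "n choose r \<le> 2 ^ n" by (rule binomial_le_pow2)
  then have "real (n choose r) \<le> 2 ^ n" by (metis of_nat_le_iff of_nat_numeral of_nat_power)
  moreover have "h \<le> real (n choose r)"
    using le by (cases "johnson_N1 n r s = 0") (auto simp: h_def divide_le_eq power_0_left)
  moreover have "0 \<le> h" by (simp add: h_def)
  ultimately have h: "\<bar>h - 1\<bar> \<le> 2 ^ n + 1" by linarith
  have bs: "0 \<le> limit_ratio r s j" "limit_ratio r s j \<le> (\<Sum>j\<le>s. limit_ratio r s j)"
    "0 \<le> (\<Sum>j\<le>s. limit_ratio r s j)" if "j \<le> s" for j
    using that limit_ratio_pos[OF assms(1)] by (auto simp: less_imp_le intro!: member_le_sum sum_nonneg)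
  define \<delta> where "\<delta> = (\<lambda>j. if j = 0 then h - 1 else - limit_ratio r s j)"
  have "\<bar>\<delta> j\<bar> \<le> 2 ^ n + 1 + (\<Sum>j\<le>s. limit_ratio r s j)" if "j \<le> s" for j
    using h bs[OF that] by (auto simp: \<delta>_def intro: add_nonneg_nonneg)
  moreover have "real (hom_cycle_johnson t n r s) = hom_expansion r s n t \<delta>"
    using assms(2) eq by (simp add: hom_expansion_def \<delta>_def power_0_left)
  ultimately show ?thesis using False by auto
qed

lemma hom_cycle_expansion:
  assumes "s < r"
  obtains C where "0 \<le> C" "\<And>n t. 2 \<le> t \<Longrightarrow> \<exists>\<delta>. (\<forall>j\<le>s. \<bar>\<delta> j\<bar> \<le> C / real n) \<and>
    real (hom_cycle_johnson t n r s) = hom_expansion r s n t \<delta>"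
proof -
  obtain C n0 where large: "\<And>n t. n0 \<le> n \<Longrightarrow> 2 \<le> t \<Longrightarrow> \<exists>\<delta>. (\<forall>j\<le>s. \<bar>\<delta> j\<bar> \<le> C / real n) \<and>
    real (hom_cycle_johnson t n r s) = hom_expansion r s n t \<delta>"
    using hom_cycle_expansion_large[OF assms] by blast
  define B where "B = 2 ^ n0 + 1 + (\<Sum>j\<le>s. limit_ratio r s j)"
  have B: "0 \<le> B"
    unfolding B_def using limit_ratio_pos[OF assms] by (intro add_nonneg_nonneg sum_nonneg) (auto simp: less_imp_le)
  \<comment> \<open>For 1 <= n < n0 the uniform bound \<open>B\<close> is at most n0 B / n; at n = 0
    the quotient is 0 and so is the bound for small \<open>n\<close>.\<close>
  define D where "D = \<bar>C\<bar> + real n0 * B"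
  show thesis
  proof (rule that[of D])
    show "0 \<le> D" using B by (simp add: D_def)
    fix n t :: nat assume t: "2 \<le> t"
    show "\<exists>\<delta>. (\<forall>j\<le>s. \<bar>\<delta> j\<bar> \<le> D / real n) \<and> real (hom_cycle_johnson t n r s) = hom_expansion r s n t \<delta>"
    proof (cases "n0 \<le> n")
      case True
      have "C / real n \<le> D / real n"
        using mult_nonneg_nonneg[OF of_nat_0_le_iff[of n0] B]
        by (intro divide_right_mono) (simp_all add: D_def)
      then show ?thesis using large[OF True t] order_trans by blast
    next
      case False
      have "(2 ^ n + 1 + (\<Sum>j\<le>s. limit_ratio r s j)) * (if n = 0 then 0 else 1) \<le> D / real n"
      proof (cases "n = 0")
        case nz: False
        have "(2::real) ^ n \<le> 2 ^ n0" using False by (intro power_increasing) auto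
        then have "2 ^ n + 1 + (\<Sum>j\<le>s. limit_ratio r s j) \<le> B" by (simp add: B_def)
        also have "B \<le> real n0 * B / real n"
          using False nz B by (simp add: field_simps mult_mono)
        also have "\<dots> \<le> D / real n" by (intro divide_right_mono) (auto simp: D_def)
        finally show ?thesis using nz by simp
      qed simp
      then show ?thesis using hom_cycle_expansion_small[OF assms t, of n] order_trans by blast
    qed
  qed
qed

section \<open>The dominant term\<close>

lemma johnson_a_pos:
  assumes "s < r" "j < s"
  shows "0 < johnson_a r s j"
  using assms unfolding johnson_a_def by (intro ln_gt_zero) (simp add: field_simps)

lemma exp_johnson_a:
  assumes "s < r" "j < s"
  shows "exp (johnson_a r s j) = real (r - j) / real (s - j)"
  using assms unfolding johnson_a_def by (intro exp_ln) simp

text \<open>The quotient is 1 + (r - s) / (s - j), which grows with \<open>j\<close>.\<close>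

lemma johnson_a_mono:
  assumes "s < r" "i \<le> j" "j < s"
  shows "johnson_a r s i \<le> johnson_a r s j"
proof -
  have "real (r - i) / real (s - i) \<le> real (r - j) / real (s - j)"
  proof -
    define p q d where "p = real (r - j)" and "q = real (s - j)" and "d = real (j - i)"
    have "real (r - i) = p + d" "real (s - i) = q + d" "0 < q" "q \<le> p" "0 \<le> d"
      using assms by (auto simp: p_def q_def d_def of_nat_diff)
    then show ?thesis
      unfolding p_def[symmetric] q_def[symmetric]
      by (auto simp: field_simps mult_left_mono)
  qed
  moreover have "0 < real (r - i) / real (s - i)" using assms by simp
  ultimately show ?thesis unfolding johnson_a_def by (intro ln_mono) auto
qed

lemma limit_ratio_Suc:
  assumes "s < r" "j < s"
  shows "limit_ratio r s (Suc j) = limit_ratio r s j * exp (- johnson_a r s j)"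
proof -
  define p q where "p = r - Suc j" and "q = s - Suc j"
  have e: "r - j = Suc p" "s - j = Suc q" using assms by (auto simp: p_def q_def)
  have "real (Suc q) * real (Suc p choose Suc q) = real (Suc p) * real (p choose q)"
    using binomial_absorption[of q "Suc p"] by (metis diff_Suc_1 of_nat_mult)
  then have "real (p choose q) = real (Suc p choose Suc q) * (real (Suc q) / real (Suc p))"
    by (simp add: field_simps del: of_nat_Suc binomial_Suc_Suc)
  also have "real (Suc q) / real (Suc p) = exp (- johnson_a r s j)"
    using exp_johnson_a[OF assms] by (simp add: exp_minus e)
  finally show ?thesis
    by (simp add: limit_ratio_def e p_def[symmetric] q_def[symmetric] del: binomial_Suc_Suc)
qed

text \<open>The quotient is exp of minus the sum of a_i, ..., a_(j-1), and a_i is the smallest of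
  these. A single threshold for \<open>t\<close> therefore handles all later terms; the next lemma
  uses the largest one, a_(j-1), for the earlier terms.\<close>

lemma limit_ratio_le_later:
  assumes "s < r" "i < s" "i \<le> j" "j \<le> s"
  shows "limit_ratio r s j / limit_ratio r s i \<le> exp (- (real (j - i) * johnson_a r s i))"
  using assms(3,4)
proof (induction j rule: dec_induct)
  case base
  then show ?case using limit_ratio_pos[OF assms(1), of i] by simp
next
  case (step j)
  have "limit_ratio r s (Suc j) / limit_ratio r s i
    = limit_ratio r s j / limit_ratio r s i * exp (- johnson_a r s j)"
    using limit_ratio_Suc[OF assms(1), of j] step by simp
  also have "\<dots> \<le> exp (- (real (j - i) * johnson_a r s i)) * exp (- johnson_a r s i)"
    using step johnson_a_mono[OF assms(1) step(1)] by (intro mult_mono) auto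
  also have "\<dots> = exp (- (real (Suc j - i) * johnson_a r s i))"
    using step by (simp add: Suc_diff_le algebra_simps flip: exp_add)
  finally show ?case .
qed

lemma limit_ratio_le_earlier:
  assumes "s < r" "i \<le> j" "0 < j" "j \<le> s"
  shows "limit_ratio r s i / limit_ratio r s j \<le> exp (real (j - i) * johnson_a r s (j - 1))"
  using assms(2)
proof (induction i rule: inc_induct)
  case base
  then show ?case using limit_ratio_pos[OF assms(1), of j] by simp
next
  case (step i)
  have "limit_ratio r s i = limit_ratio r s (Suc i) * exp (johnson_a r s i)"
    using limit_ratio_Suc[OF assms(1), of i] step assms(4) by (simp add: exp_minus)
  then have "limit_ratio r s i / limit_ratio r s j
    = limit_ratio r s (Suc i) / limit_ratio r s j * exp (johnson_a r s i)"
    by simp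
  also have "\<dots> \<le> exp (real (j - Suc i) * johnson_a r s (j - 1)) * exp (johnson_a r s (j - 1))"
    using step assms johnson_a_mono[OF assms(1), of i "j - 1"] by (intro mult_mono) auto
  also have "\<dots> = exp (real (j - i) * johnson_a r s (j - 1))"
  proof -
    have "real (j - i) = real (j - Suc i) + 1" using step by linarith
    then show ?thesis by (simp add: algebra_simps flip: exp_add)
  qed
  finally show ?case .
qed

section \<open>Comparison of terms on the logarithmic scale\<close>

text \<open>Here \<open>t\<close> has no upper bound, so the t-th power of 1 + O(1/n) need not stay
  bounded. Part of \<open>eps\<close> is spent instead: a slightly smaller rate a' eventually
  absorbs c/n, and the threshold still leaves n exp(-t a') <= n^(-e).\<close>

lemma long_cycle_term_vanishes:
  fixes t :: "nat \<Rightarrow> nat"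
  assumes "1 \<le> d" "0 < a" "0 < eps" "0 \<le> q" "q \<le> exp (- (real d * a))" "0 \<le> c"
    and t: "eventually (\<lambda>n. (1 + eps) * ln (real n) / a < real (t n)) at_top"
  shows "(\<lambda>n. real n ^ d * (q + c / real n) ^ t n) \<longlonglongrightarrow> 0"
proof -
  \<comment> \<open>Half of \<open>eps\<close> goes into the rate; \<open>e\<close> is the exponent
    left over, positive because 1 + eps > 1 + eps/2.\<close>
  define a' e where "a' = a / (1 + eps / 2)" and "e = (1 + eps) / (1 + eps / 2) - 1"
  have e: "0 < e" "0 < a'" using assms by (auto simp: e_def a'_def field_simps)
  have "a' < a" using assms by (simp add: a'_def field_simps)
  then have "q < exp (- (real d * a'))"
    using assms by (intro le_less_trans[OF assms(5)]) simp
  moreover have "(\<lambda>n. q + c / real n) \<longlonglongrightarrow> q" by real_asymp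
  ultimately have "eventually (\<lambda>n. q + c / real n < exp (- (real d * a'))) at_top"
    using order_tendstoD(2) by blast
  from this t eventually_gt_at_top[of 1]
  have "eventually (\<lambda>n. norm (real n ^ d * (q + c / real n) ^ t n) \<le> exp (- (real d * e * ln (real n)))) at_top"
  proof eventually_elim
    case (elim n)
    have base: "0 \<le> q + c / real n" using assms by simp
    have "(1 + eps) * ln (real n) \<le> real (t n) * a" using elim assms by (simp add: field_simps)
    then have "(1 + eps) * ln (real n) / (1 + eps / 2) \<le> real (t n) * a / (1 + eps / 2)"
      using assms by (intro divide_right_mono) auto
    then have "ln (real n) - real (t n) * a' \<le> - (e * ln (real n))"
      by (simp add: a'_def e_def left_diff_distrib)
    then have le: "real d * (ln (real n) - real (t n) * a') \<le> real d * (- (e * ln (real n)))"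
      by (intro mult_left_mono) auto
    have "norm (real n ^ d * (q + c / real n) ^ t n) = real n ^ d * (q + c / real n) ^ t n"
      using base by simp
    also have "\<dots> \<le> real n ^ d * exp (- (real d * a')) ^ t n"
      using base elim by (intro mult_left_mono power_mono) auto
    also have "\<dots> = exp (real d * (ln (real n) - real (t n) * a'))"
    proof -
      have "real n ^ d = exp (real d * ln (real n))" using elim by (simp add: exp_of_nat_mult)
      moreover have "exp (- (real d * a')) ^ t n = exp (real (t n) * (- (real d * a')))"
        by (simp only: exp_of_nat_mult)
      ultimately show ?thesis by (simp add: algebra_simps flip: exp_add)
    qed
    also have "\<dots> \<le> exp (- (real d * e * ln (real n)))" using le by simp
    finally show ?case .
  qed
  moreover have "(\<lambda>n. exp (- (real d * e * ln (real n)))) \<longlonglongrightarrow> 0"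
  proof -
    have "0 < real d * e" using e assms(1) by simp
    then show ?thesis by real_asymp
  qed
  ultimately show ?thesis by (rule Lim_null_comparison)
qed

lemma short_cycle_term_vanishes:
  fixes t :: "nat \<Rightarrow> nat"
  assumes "1 \<le> d" "0 < a" "0 < eps" "0 \<le> q" "q \<le> exp (real d * a)" "0 \<le> c"
    and t: "eventually (\<lambda>n. real (t n) < (1 - eps) * ln (real n) / a) at_top"
  shows "(\<lambda>n. (q + c / real n) ^ t n / real n ^ d) \<longlonglongrightarrow> 0"
proof -
  \<comment> \<open>The rate is now enlarged, and the remaining gain is 1 - (1 - eps)(1 + eps) =
    eps^2.\<close>
  define a' e where "a' = a * (1 + eps)" and "e = eps\<^sup>2"
  have e: "0 < e" "0 < a'" using assms by (auto simp: e_def a'_def)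
  have "a < a'" using assms by (simp add: a'_def)
  then have "q < exp (real d * a')"
    using assms by (intro le_less_trans[OF assms(5)]) simp
  moreover have "(\<lambda>n. q + c / real n) \<longlonglongrightarrow> q" by real_asymp
  ultimately have "eventually (\<lambda>n. q + c / real n < exp (real d * a')) at_top"
    using order_tendstoD(2) by blast
  from this t eventually_gt_at_top[of 1]
  have "eventually (\<lambda>n. norm ((q + c / real n) ^ t n / real n ^ d) \<le> exp (- (real d * e * ln (real n)))) at_top"
  proof eventually_elim
    case (elim n)
    have base: "0 \<le> q + c / real n" using assms by simp
    have "real (t n) * a \<le> (1 - eps) * ln (real n)" using elim assms by (simp add: field_simps)
    then have "real (t n) * a * (1 + eps) \<le> (1 - eps) * ln (real n) * (1 + eps)"
      using assms by (intro mult_right_mono) auto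
    then have "real (t n) * a' - ln (real n) \<le> - (e * ln (real n))"
      by (simp add: a'_def e_def power2_eq_square algebra_simps)
    then have le: "real d * (real (t n) * a' - ln (real n)) \<le> real d * (- (e * ln (real n)))"
      by (intro mult_left_mono) auto
    have "norm ((q + c / real n) ^ t n / real n ^ d) = (q + c / real n) ^ t n / real n ^ d"
      using base by simp
    also have "\<dots> \<le> exp (real d * a') ^ t n / real n ^ d"
      using base elim by (intro divide_right_mono power_mono) auto
    also have "\<dots> = exp (real d * (real (t n) * a' - ln (real n)))"
    proof -
      have "real n ^ d = exp (real d * ln (real n))" using elim by (simp add: exp_of_nat_mult)
      moreover have "exp (real d * a') ^ t n = exp (real (t n) * (real d * a'))"
        by (simp only: exp_of_nat_mult)
      ultimately show ?thesis by (simp add: algebra_simps flip: exp_diff)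
    qed
    also have "\<dots> \<le> exp (- (real d * e * ln (real n)))" using le by simp
    finally show ?case .
  qed
  moreover have "(\<lambda>n. exp (- (real d * e * ln (real n)))) \<longlonglongrightarrow> 0"
  proof -
    have "0 < real d * e" using e assms(1) by simp
    then show ?thesis by real_asymp
  qed
  ultimately show ?thesis by (rule Lim_null_comparison)
qed

text \<open>Logarithmic \<open>t\<close> makes t/n vanish; Bernoulli's inequality and 1 + x <= exp x
  enclose the power. It serves the dominant term with index at least 1, whose regime bounds
  \<open>t\<close> from above.\<close>

lemma power_near_one_tendsto:
  fixes t :: "nat \<Rightarrow> nat" and x :: "nat \<Rightarrow> real"
  assumes x: "eventually (\<lambda>n. \<bar>x n\<bar> \<le> c / real n) at_top"
    and t: "eventually (\<lambda>n. real (t n) \<le> k * ln (real n)) at_top"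
  shows "(\<lambda>n. (1 + x n) ^ t n) \<longlonglongrightarrow> 1"
proof (rule tendsto_sandwich)
  have small: "eventually (\<lambda>n. c / real n \<le> 1) at_top" by real_asymp
  have prod: "real (t n) * \<bar>x n\<bar> \<le> (k * ln (real n)) * (c / real n)"
    if "\<bar>x n\<bar> \<le> c / real n" "real (t n) \<le> k * ln (real n)" for n
    using that by (intro mult_mono order_trans[OF of_nat_0_le_iff that(2)]) auto
  show "eventually (\<lambda>n. 1 - (k * ln (real n)) * (c / real n) \<le> (1 + x n) ^ t n) at_top"
    using x t small
  proof eventually_elim
    case (elim n)
    have "1 + real (t n) * x n \<le> (1 + x n) ^ t n"
      using elim by (intro Bernoulli_inequality) auto
    moreover have "- (real (t n) * \<bar>x n\<bar>) \<le> real (t n) * x n"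
      using mult_left_mono[of "- \<bar>x n\<bar>" "x n" "real (t n)"] by simp
    ultimately show ?case using prod[OF elim(1,2)] by linarith
  qed
  show "eventually (\<lambda>n. (1 + x n) ^ t n \<le> exp ((k * ln (real n)) * (c / real n))) at_top"
    using x t small
  proof eventually_elim
    case (elim n)
    have "(1 + x n) ^ t n \<le> exp (\<bar>x n\<bar>) ^ t n"
    proof (intro power_mono)
      show "1 + x n \<le> exp \<bar>x n\<bar>"
        using exp_ge_add_one_self[of "\<bar>x n\<bar>"] by linarith
    qed (use elim in auto)
    also have "\<dots> = exp (real (t n) * \<bar>x n\<bar>)" by (simp only: exp_of_nat_mult)
    also have "\<dots> \<le> exp ((k * ln (real n)) * (c / real n))" using prod[OF elim(1,2)] by simp
    finally show ?case .
  qed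
  show "(\<lambda>n. 1 - (k * ln (real n)) * (c / real n)) \<longlonglongrightarrow> 1" by real_asymp
  show "(\<lambda>n. exp ((k * ln (real n)) * (c / real n))) \<longlonglongrightarrow> 1" by real_asymp
qed

lemma johnson_I_lower:
  assumes "johnson_I r s eps j n t" "j < s"
  shows "(1 + eps) * ln (real n) / johnson_a r s j < real t"
  using assms by (auto simp: johnson_I_def split: if_splits)

lemma johnson_I_upper:
  assumes "johnson_I r s eps j n t" "0 < j"
  shows "real t < (1 - eps) * ln (real n) / johnson_a r s (j - 1)"
  using assms by (auto simp: johnson_I_def split: if_splits)

text \<open>The expansion requires \<open>t \<ge> 2\<close>; below index \<open>s\<close> this comes
  from the logarithmic lower threshold, which exceeds 1 for large \<open>n\<close>.\<close>

lemma johnson_I_ge_2: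
  assumes "s < r" "1 \<le> s" "0 < eps" "j \<le> s"
  shows "eventually (\<lambda>n. \<forall>t. johnson_I r s eps j n t \<longrightarrow> 2 \<le> t) at_top"
proof (cases "j = s")
  case True
  then show ?thesis using assms(2) by (auto simp: johnson_I_def)
next
  case False
  then have j: "j < s" using assms by simp
  have "0 < (1 + eps) / johnson_a r s j" using johnson_a_pos[OF assms(1) j] assms(3) by simp
  then have "eventually (\<lambda>n. 1 \<le> (1 + eps) / johnson_a r s j * ln (real n)) at_top" by real_asymp
  then show ?thesis
  proof eventually_elim
    case (elim n)
    show ?case
    proof (intro allI impI)
      fix t assume "johnson_I r s eps j n t"
      from johnson_I_lower[OF this j] elim show "2 \<le> t" by simp
    qed
  qed
qed

text \<open>After division by term \<open>J\<close>, a later term behaves like a power of n exp(-t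
  a_J) and an earlier one like a power of exp(t a_(J-1)) / n. The two thresholds of the regime send
  both to 0.\<close>

lemma hom_cycle_regime:
  assumes "s < r" "1 \<le> s" "0 < eps" "J \<le> s"
    and I: "eventually (\<lambda>n. johnson_I r s eps J n (t n)) at_top"
  shows "(\<lambda>n. real (hom_cycle_johnson (t n) n r s)) \<sim>[at_top]
    (\<lambda>n. real (johnson_N1 n r s) ^ t n * (real n ^ J / fact J) * limit_ratio r s J ^ t n)"
proof -
  obtain C where C: "0 \<le> C" and "\<And>n t. 2 \<le> t \<Longrightarrow> \<exists>\<delta>. (\<forall>j\<le>s. \<bar>\<delta> j\<bar> \<le> C / real n) \<and>
    real (hom_cycle_johnson t n r s) = hom_expansion r s n t \<delta>"
    using hom_cycle_expansion[OF assms(1)] by blast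
  then have "\<forall>n. \<exists>\<delta>. 2 \<le> t n \<longrightarrow> (\<forall>j\<le>s. \<bar>\<delta> j\<bar> \<le> C / real n) \<and>
    real (hom_cycle_johnson (t n) n r s) = hom_expansion r s n (t n) \<delta>"
    by blast
  then obtain \<delta> where \<delta>: "\<And>n. 2 \<le> t n \<Longrightarrow> (\<forall>j\<le>s. \<bar>\<delta> n j\<bar> \<le> C / real n) \<and>
    real (hom_cycle_johnson (t n) n r s) = hom_expansion r s n (t n) (\<delta> n)"
    by metis
  define b where "b = limit_ratio r s"
  have b: "0 < b j" for j using limit_ratio_pos[OF assms(1)] by (simp add: b_def)
  have t2: "eventually (\<lambda>n. 2 \<le> t n) at_top"
    using I johnson_I_ge_2[OF assms(1-4)] by eventually_elim blast
  then have \<delta>_le: "eventually (\<lambda>n. \<bar>\<delta> n j\<bar> \<le> C / real n) at_top" if "j \<le> s" for j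
    by eventually_elim (use \<delta> that in blast)
  define T where "T = (\<lambda>j n. if j = 0 then 1 + \<delta> n 0 else real n ^ j / fact j * (b j + \<delta> n j) ^ t n)"
  define g where "g = (\<lambda>n. real n ^ J / fact J * b J ^ t n)"
  have \<delta>0: "(\<lambda>n. 1 + \<delta> n 0) \<longlonglongrightarrow> 1"
  proof -
    have "(\<lambda>n. C / real n) \<longlonglongrightarrow> 0" by real_asymp
    with \<delta>_le[of 0] have "(\<lambda>n. \<delta> n 0) \<longlonglongrightarrow> 0"
      by (intro Lim_null_comparison[of "\<lambda>n. \<delta> n 0"]) auto
    from tendsto_add[OF tendsto_const this] show ?thesis by simp
  qed
  have vanish: "(\<lambda>n. T j n / g n) \<longlonglongrightarrow> 0" if j: "j \<le> s" "j \<noteq> J" for j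
  proof (cases "J < j")
    case True
    \<comment> \<open>The error of the base relative to the dominant base is again O(1/n), with
      \<open>c\<close> as its constant.\<close>
    define q c where "q = b j / b J" and "c = C / b J"
    have J: "J < s" using True j by simp
    have "(\<lambda>n. real n ^ (j - J) * (q + c / real n) ^ t n) \<longlonglongrightarrow> 0"
    proof (rule long_cycle_term_vanishes)
      show "q \<le> exp (- (real (j - J) * johnson_a r s J))"
        unfolding q_def b_def using True j J by (intro limit_ratio_le_later assms(1)) auto
      show "eventually (\<lambda>n. (1 + eps) * ln (real n) / johnson_a r s J < real (t n)) at_top"
        using I by eventually_elim (rule johnson_I_lower[OF _ J])
    qed (use True C b assms J in \<open>auto simp: q_def c_def less_imp_le intro: johnson_a_pos\<close>)
    from tendsto_mult_right_zero[OF this, of "fact J / fact j"]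
    have "(\<lambda>n. fact J / fact j * (real n ^ (j - J) * (q + c / real n) ^ t n)) \<longlonglongrightarrow> 0" .
    moreover have "eventually (\<lambda>n. norm (T j n / g n)
        \<le> fact J / fact j * (real n ^ (j - J) * (q + c / real n) ^ t n)) at_top"
      using \<delta>_le[OF j(1)] eventually_gt_at_top[of 0]
    proof eventually_elim
      case (elim n)
      have "real n ^ j = real n ^ J * real n ^ (j - J)" using True by (simp flip: power_add)
      then have "T j n / g n = fact J / fact j * (real n ^ (j - J) * ((b j + \<delta> n j) / b J) ^ t n)"
        using True elim b[of J] by (simp add: T_def g_def power_divide)
      moreover have "\<bar>(b j + \<delta> n j) / b J\<bar> \<le> q + c / real n"
      proof -
        have "\<bar>b j + \<delta> n j\<bar> \<le> b j + C / real n" using elim b[of j] by linarith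
        then have "\<bar>b j + \<delta> n j\<bar> / b J \<le> (b j + C / real n) / b J"
          using b[of J] by (intro divide_right_mono) auto
        also have "\<dots> = q + c / real n" by (simp add: q_def c_def add_divide_distrib mult.commute)
        finally show ?thesis using b[of J] by (simp only: abs_divide abs_of_pos)
      qed
      then have "\<bar>((b j + \<delta> n j) / b J) ^ t n\<bar> \<le> (q + c / real n) ^ t n"
        unfolding power_abs by (intro power_mono) auto
      ultimately show ?case
        by (simp only: real_norm_def abs_mult) (intro mult_mono; simp)
    qed
    ultimately show ?thesis by (rule Lim_null_comparison[rotated])
  next
    case False
    then have jJ: "j < J" using j by simp
    \<comment> \<open>Term 0 has no perturbation inside the power, so its \<open>c\<close> is 0; its
      factor 1 + \<delta> 0 is at most 2 in absolute value for large \<open>n\<close>, which is the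
      origin of the 2 below.\<close>
    define q c where "q = b j / b J" and "c = (if j = 0 then 0 else C / b J)"
    have "(\<lambda>n. (q + c / real n) ^ t n / real n ^ (J - j)) \<longlonglongrightarrow> 0"
    proof (rule short_cycle_term_vanishes)
      show "q \<le> exp (real (J - j) * johnson_a r s (J - 1))"
        unfolding q_def b_def using jJ assms by (intro limit_ratio_le_earlier) auto
      show "eventually (\<lambda>n. real (t n) < (1 - eps) * ln (real n) / johnson_a r s (J - 1)) at_top"
        using I by eventually_elim (rule johnson_I_upper, use jJ in auto)
    qed (use jJ C b assms in \<open>auto simp: q_def c_def less_imp_le intro!: johnson_a_pos\<close>)
    from tendsto_mult_right_zero[OF this, of "2 * (fact J / fact j)"]
    have "(\<lambda>n. 2 * (fact J / fact j) * ((q + c / real n) ^ t n / real n ^ (J - j))) \<longlonglongrightarrow> 0" .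
    moreover have "eventually (\<lambda>n. C / real n \<le> 1) at_top" by real_asymp
    then have "eventually (\<lambda>n. norm (T j n / g n)
        \<le> 2 * (fact J / fact j) * ((q + c / real n) ^ t n / real n ^ (J - j))) at_top"
      using \<delta>_le[OF j(1)] eventually_gt_at_top[of 0]
    proof eventually_elim
      case (elim n)
      show ?case
      proof (cases "j = 0")
        case True
        have "q = 1 / b J" using True limit_ratio_0[OF assms(1)] by (simp add: q_def b_def)
        then have "norm (T j n / g n) = \<bar>1 + \<delta> n 0\<bar> * (fact J * (q ^ t n / real n ^ J))"
          using True b[of J] by (simp add: T_def g_def abs_mult power_divide)
        also have "\<dots> \<le> 2 * (fact J * (q ^ t n / real n ^ J))"
        proof (rule mult_right_mono)
          show "\<bar>1 + \<delta> n 0\<bar> \<le> 2" using elim(1,2) unfolding True by linarith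
        qed (use b in \<open>auto simp: q_def less_imp_le\<close>)
        finally show ?thesis using True by (simp add: c_def mult.assoc)
      next
        case False
        have "real n ^ J = real n ^ j * real n ^ (J - j)" using jJ by (simp flip: power_add)
        then have "T j n / g n = fact J / fact j * (((b j + \<delta> n j) / b J) ^ t n / real n ^ (J - j))"
          using False elim b[of J] by (simp add: T_def g_def power_divide mult_ac)
        moreover have "\<bar>(b j + \<delta> n j) / b J\<bar> \<le> q + c / real n"
        proof -
          have "\<bar>b j + \<delta> n j\<bar> \<le> b j + C / real n" using elim b[of j] by linarith
          then have "\<bar>b j + \<delta> n j\<bar> / b J \<le> (b j + C / real n) / b J"
            using b[of J] by (intro divide_right_mono) auto
          also have "\<dots> = q + c / real n"
            using False by (simp add: q_def c_def add_divide_distrib mult.commute)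
          finally show ?thesis using b[of J] by (simp only: abs_divide abs_of_pos)
        qed
        then have "\<bar>((b j + \<delta> n j) / b J) ^ t n\<bar> \<le> (q + c / real n) ^ t n"
          unfolding power_abs by (intro power_mono) auto
        then have "fact J / fact j * (\<bar>((b j + \<delta> n j) / b J) ^ t n\<bar> / real n ^ (J - j))
          \<le> fact J / fact j * ((q + c / real n) ^ t n / real n ^ (J - j))"
          by (intro mult_left_mono divide_right_mono) auto
        moreover have "0 \<le> fact J / fact j * ((q + c / real n) ^ t n / real n ^ (J - j))"
          using b C by (auto simp: q_def c_def less_imp_le)
        ultimately show ?thesis by (simp add: abs_mult)
      qed
    qed
    ultimately show ?thesis by (rule Lim_null_comparison[rotated])
  qed
  \<comment> \<open>For \<open>J = 0\<close>, where \<open>t\<close> is unbounded, the term is 1 +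
    \<delta> 0 and no power has to be estimated.\<close>
  have main: "(\<lambda>n. T J n / g n) \<longlonglongrightarrow> 1"
  proof (cases "J = 0")
    case True
    then show ?thesis using \<delta>0 limit_ratio_0[OF assms(1)] by (simp add: T_def g_def b_def)
  next
    case False
    define a where "a = johnson_a r s (J - 1)"
    have a: "0 < a" unfolding a_def using False assms by (intro johnson_a_pos) auto
    have "(\<lambda>n. (1 + \<delta> n J / b J) ^ t n) \<longlonglongrightarrow> 1"
    proof (rule power_near_one_tendsto)
      show "eventually (\<lambda>n. \<bar>\<delta> n J / b J\<bar> \<le> (C / b J) / real n) at_top"
        using \<delta>_le[OF assms(4)]
      proof eventually_elim
        case (elim n)
        from divide_right_mono[OF this, of "b J"] b[of J] show ?case by (simp add: mult.commute)
      qed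
      show "eventually (\<lambda>n. real (t n) \<le> (1 - eps) / a * ln (real n)) at_top"
        using I
      proof eventually_elim
        case (elim n)
        from johnson_I_upper[OF this] False show ?case by (simp add: a_def)
      qed
    qed
    moreover have "eventually (\<lambda>n. (1 + \<delta> n J / b J) ^ t n = T J n / g n) at_top"
      using eventually_gt_at_top[of 0]
    proof eventually_elim
      case (elim n)
      have "1 + \<delta> n J / b J = (b J + \<delta> n J) / b J" using b[of J] by (simp add: add_divide_distrib)
      then show ?case using elim False b[of J] by (simp add: T_def g_def power_divide)
    qed
    ultimately show ?thesis by (rule Lim_transform_eventually)
  qed
  have "(\<lambda>n. \<Sum>j\<le>s. T j n / g n) \<longlonglongrightarrow> (\<Sum>j\<le>s. if j = J then 1 else 0)"
    using vanish main by (intro tendsto_sum) auto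
  then have lim: "(\<lambda>n. \<Sum>j\<le>s. T j n / g n) \<longlonglongrightarrow> 1" using assms(4) by simp
  have "(\<lambda>n. real (hom_cycle_johnson (t n) n r s) / (real (johnson_N1 n r s) ^ t n * g n)) \<longlonglongrightarrow> 1"
  proof (rule Lim_transform_eventually[OF lim])
    show "eventually (\<lambda>n. (\<Sum>j\<le>s. T j n / g n)
      = real (hom_cycle_johnson (t n) n r s) / (real (johnson_N1 n r s) ^ t n * g n)) at_top"
      using t2 eventually_gt_at_top[of "2 * r"]
    proof eventually_elim
      case (elim n)
      have N1: "0 < johnson_N1 n r s"
        using elim assms(1) by (simp add: johnson_N1_def)
      have "(\<Sum>j\<le>s. T j n) = 1 + \<delta> n 0 + (\<Sum>j=1..s. real n ^ j / fact j * (b j + \<delta> n j) ^ t n)"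
        by (simp add: atMost_atLeast0 sum.atLeast_Suc_atMost T_def)
      then have "real (hom_cycle_johnson (t n) n r s) = real (johnson_N1 n r s) ^ t n * (\<Sum>j\<le>s. T j n)"
        using \<delta>[OF elim(1)] by (simp add: hom_expansion_def b_def)
      then show ?case using N1 by (simp add: sum_divide_distrib)
    qed
  qed
  then show ?thesis
    by (intro asymp_equivI') (simp add: g_def b_def mult.assoc)
qed

theorem theorem3:
  fixes r s :: nat
  assumes "s < r"
  shows "(\<exists>C::real. \<forall>n t::nat. t \<ge> 2 \<longrightarrow>
            (\<exists>\<delta>::nat \<Rightarrow> real. (\<forall>j\<le>s. \<bar>\<delta> j\<bar> \<le> C / real n) \<and>
               real (hom_cycle_johnson t n r s) =
                 real (johnson_N1 n r s) ^ t *
                 (1 + \<delta> 0 + (\<Sum>j=1..s. real n ^ j / fact j *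
                    (real ((r - j) choose (s - j)) / real (r choose s) + \<delta> j) ^ t))))
       \<and> (1 \<le> s \<longrightarrow> (\<forall>eps::real. eps > 0 \<longrightarrow> (\<forall>j\<le>s. \<forall>t::nat \<Rightarrow> nat.
            (\<forall>\<^sub>F n in at_top. johnson_I r s eps j n (t n)) \<longrightarrow>
            (\<lambda>n. real (hom_cycle_johnson (t n) n r s)) \<sim>[at_top]
            (\<lambda>n. real (johnson_N1 n r s) ^ (t n) * (real n ^ j / fact j) *
                 (real ((r - j) choose (s - j)) / real (r choose s)) ^ (t n)))))"
proof (intro conjI impI allI)
  obtain C where "0 \<le> C" "\<And>n t. 2 \<le> t \<Longrightarrow> \<exists>\<delta>. (\<forall>j\<le>s. \<bar>\<delta> j\<bar> \<le> C / real n) \<and>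
    real (hom_cycle_johnson t n r s) = hom_expansion r s n t \<delta>"
    using hom_cycle_expansion[OF assms] by blast
  then show "\<exists>C::real. \<forall>n t::nat. t \<ge> 2 \<longrightarrow>
            (\<exists>\<delta>::nat \<Rightarrow> real. (\<forall>j\<le>s. \<bar>\<delta> j\<bar> \<le> C / real n) \<and>
               real (hom_cycle_johnson t n r s) =
                 real (johnson_N1 n r s) ^ t *
                 (1 + \<delta> 0 + (\<Sum>j=1..s. real n ^ j / fact j *
                    (real ((r - j) choose (s - j)) / real (r choose s) + \<delta> j) ^ t)))"
    unfolding hom_expansion_def limit_ratio_def by blast
next
  fix eps :: real and j and t :: "nat \<Rightarrow> nat"
  assume "1 \<le> s" "0 < eps" "j \<le> s" "\<forall>\<^sub>F n in at_top. johnson_I r s eps j n (t n)"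
  from hom_cycle_regime[OF assms this]
  show "(\<lambda>n. real (hom_cycle_johnson (t n) n r s)) \<sim>[at_top]
            (\<lambda>n. real (johnson_N1 n r s) ^ (t n) * (real n ^ j / fact j) *
                 (real ((r - j) choose (s - j)) / real (r choose s)) ^ (t n))"
    unfolding limit_ratio_def .
qed

end
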